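(* Let $\varrho\colon a_i\mapsto w_i$ be a primitive and aperiodic constant-length substitution on an $n_a$-letter alphabet, with $|w_i|=L$ for all $i$, and assume that its columns are either bijective or constant. Suppose further that the group $G'$ generated by the bijective columns is Abelian (but not necessarily transitive in the symmetric group $\Sigma_{n_a}$). Then, all Lyapunov exponents associated to $\varrho$ are strictly positive.
   Context: Let $\mathcal A=\{a_1,\dots,a_{n_a}\}$ be a finite alphabet. $\varrho$ is primitive if the matrix $M_{ij}=\#\{a_i\text{ in }\varrho(a_j)\}$ is primitive. For $0\leqslant r\leqslant L-1$, the $r$-th column of $\varrho$ is the map $\mathcal A\to\mathcal A$ sending $a_i$ to the letter at position $r$ (counting from $0$) of $w_i=\varrho(a_i)$. A column is bijective if this map is a permutation of $\mathcal A$ (viewed as an element of the symmetric group $\Sigma_{n_a}$), and constant if it sends all letters to the same letter. Aperiodic means that the elements of the hull generated by $\varrho$ (the orbit closure of a bi-infinite fixed point of $\varrho$ or of a power of it) have no non-trivial periods. Fourier matrix: $B_{ij}(k)=\sum_{t\in T_{ij}}\mathrm e^{2\pi\mathrm i tk}$, where $T_{ij}$ is the set of positions $r\in\{0,\dots,L-1\}$ at which $a_i$ occurs in $\varrho(a_j)$. The Lyapunov exponents associated to $\varrho$ are those of the outward iteration $v(L^nk)=L^{n/2}B^{-1}(L^{n-1}k)\cdots B^{-1}(Lk)B^{-1}(k)v(k)$, that is, the values of $\limsup_{n\to\infty}\frac1n\log\bigl\|L^{n/2}B^{-1}(L^{n-1}k)\cdots B^{-1}(k)\,v\bigr\|$ for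 $0\neq v\in\mathbb C^{n_a}$; they are considered for Lebesgue-a.e. $k\in\mathbb R$. *)

theory Defs
  imports "HOL-Analysis.Analysis" "HOL-Algebra.Bij" "HOL-Algebra.Generated_Groups"
begin

text \<open>
  The finite alphabet is a type \<open>'a :: finite\<close>, so that $n_a$ is \<open>CARD('a)\<close>, and a
  substitution is the map \<open>\<rho> :: 'a \<Rightarrow> 'a list\<close> sending a letter to its image word.
\<close>

definition constant_length :: "('a \<Rightarrow> 'a list) \<Rightarrow> nat \<Rightarrow> bool" where
  "constant_length \<rho> L \<longleftrightarrow> (\<forall>a. length (\<rho> a) = L)"

definition subst_matrix :: "('a::finite \<Rightarrow> 'a list) \<Rightarrow> nat ^ 'a ^ 'a" where
  "subst_matrix \<rho> = (\<chi> i j. count_list (\<rho> j) i)"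

text \<open>
  The operation \<open>^\<close> on matrices is the entrywise power, so the matrix power is an iterated \<open>**\<close>.
\<close>
definition primitive_matrix :: "nat ^ 'n ^ 'n \<Rightarrow> bool" where
  "primitive_matrix M \<longleftrightarrow> (\<exists>N\<ge>1. \<forall>i j. (((**) M ^^ N) (mat 1)) $ i $ j > 0)"

definition primitive_subst :: "('a::finite \<Rightarrow> 'a list) \<Rightarrow> bool" where
  "primitive_subst \<rho> \<longleftrightarrow> primitive_matrix (subst_matrix \<rho>)"


text \<open>
  The action of a substitution of constant length \<open>L\<close> on bi-infinite words: the image of the
  letter at position \<open>m\<close> occupies the positions \<open>L m, \<dots>, L m + L - 1\<close>.
\<close>
definition subst_biinf :: "('a \<Rightarrow> 'a list) \<Rightarrow> nat \<Rightarrow> (int \<Rightarrow> 'a) \<Rightarrow> (int \<Rightarrow> 'a)" where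
  "subst_biinf \<rho> L w = (\<lambda>n. \<rho> (w (n div int L)) ! nat (n mod int L))"

definition shift_biinf :: "int \<Rightarrow> (int \<Rightarrow> 'a) \<Rightarrow> (int \<Rightarrow> 'a)" where
  "shift_biinf t w = (\<lambda>n. w (n + t))"

definition biinf_topology :: "(int \<Rightarrow> 'a) topology" where
  "biinf_topology = product_topology (\<lambda>_. discrete_topology UNIV) UNIV"

definition biinf_hull :: "(int \<Rightarrow> 'a) \<Rightarrow> (int \<Rightarrow> 'a) set" where
  "biinf_hull w = biinf_topology closure_of (range (\<lambda>t. shift_biinf t w))"

text \<open>
  For a primitive substitution it does not matter which fixed point generates the hull:
  aperiodicity holds for one of them if and only if it holds for all of them.
\<close>
definition aperiodic_subst :: "('a \<Rightarrow> 'a list) \<Rightarrow> nat \<Rightarrow> bool" where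
  "aperiodic_subst \<rho> L \<longleftrightarrow>
     (\<exists>w. (\<exists>p\<ge>1. (subst_biinf \<rho> L ^^ p) w = w) \<and>
          (\<forall>x\<in>biinf_hull w. \<forall>t. t \<noteq> 0 \<longrightarrow> shift_biinf t x \<noteq> x))"


definition subst_column :: "('a \<Rightarrow> 'a list) \<Rightarrow> nat \<Rightarrow> 'a \<Rightarrow> 'a" where
  "subst_column \<rho> r = (\<lambda>a. \<rho> a ! r)"

definition constant_map :: "('a \<Rightarrow> 'a) \<Rightarrow> bool" where
  "constant_map f \<longleftrightarrow> (\<exists>c. \<forall>a. f a = c)"

definition bijective_columns :: "('a \<Rightarrow> 'a list) \<Rightarrow> nat \<Rightarrow> ('a \<Rightarrow> 'a) set" where
  "bijective_columns \<rho> L = {subst_column \<rho> r | r. r < L \<and> bij (subst_column \<rho> r)}"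

definition column_group :: "('a \<Rightarrow> 'a list) \<Rightarrow> nat \<Rightarrow> ('a \<Rightarrow> 'a) monoid" where
  "column_group \<rho> L = subgroup_generated (BijGroup UNIV) (bijective_columns \<rho> L)"


definition positions :: "('a \<Rightarrow> 'a list) \<Rightarrow> nat \<Rightarrow> 'a \<Rightarrow> 'a \<Rightarrow> nat set" where
  "positions \<rho> L i j = {r. r < L \<and> \<rho> j ! r = i}"

definition fourier_matrix :: "('a::finite \<Rightarrow> 'a list) \<Rightarrow> nat \<Rightarrow> real \<Rightarrow> complex ^ 'a ^ 'a" where
  "fourier_matrix \<rho> L k =
     (\<chi> i j. \<Sum>t\<in>positions \<rho> L i j. exp (2 * of_real pi * \<i> * of_nat t * of_real k))"

text \<open>
  \<open>outward_iterate \<rho> L k v n\<close> is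
  $L^{n/2} B^{-1}(L^{n-1}k) \cdots B^{-1}(Lk) B^{-1}(k) v$; it is meaningful when all the
  matrices $B(L^m k)$ are invertible.
\<close>
primrec inverse_cocycle ::
    "('a::finite \<Rightarrow> 'a list) \<Rightarrow> nat \<Rightarrow> real \<Rightarrow> nat \<Rightarrow> complex ^ 'a ^ 'a" where
  "inverse_cocycle \<rho> L k 0 = mat 1"
| "inverse_cocycle \<rho> L k (Suc n) =
     matrix_inv (fourier_matrix \<rho> L (real L ^ n * k)) ** inverse_cocycle \<rho> L k n"

definition outward_iterate ::
    "('a::finite \<Rightarrow> 'a list) \<Rightarrow> nat \<Rightarrow> real \<Rightarrow> complex ^ 'a \<Rightarrow> nat \<Rightarrow> complex ^ 'a" where
  "outward_iterate \<rho> L k v n =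
     (real L powr (real n / 2)) *\<^sub>R (inverse_cocycle \<rho> L k n *v v)"

definition lyapunov_exponents :: "('a::finite \<Rightarrow> 'a list) \<Rightarrow> nat \<Rightarrow> real \<Rightarrow> ereal set" where
  "lyapunov_exponents \<rho> L k =
     {limsup (\<lambda>n. ereal (1 / real n * ln (norm (outward_iterate \<rho> L k v n)))) | v. v \<noteq> 0}"

end

theory Submission
  imports Defs
begin

text \<open>
  A functional $\ell$ on the alphabet with $\ell(g(j)) = \omega_g\,\ell(j)$ for every bijective column
  $g$ satisfies $\langle\ell, B(k)y\rangle = p(k)\,\langle\ell, y\rangle$ for all $y$ with zero
  coordinate sum, because constant columns vanish there; here $p$ is a trigonometric polynomial of
  degree less than $L$ whose coefficients are zero or roots of unity. On the remaining vectors,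
  $\ell = 1$ plays this role. As the bijective columns commute and have finite order, such $\ell$
  separate vectors, so it suffices to show that
  $P_n(k) = \prod_{j<n} |p(L^j k)|$ is almost surely $O(s^n)$ with some $s < \sqrt L$.

  Instead of Birkhoff's theorem and Jensen's inequality for the Mahler measure, a transfer operator
  is used. With $f = |p|$ and $T h(y) = \frac1L \sum_{i<L} h(\frac{y+i}L)$, one has
  $\int_0^1 P_{n+2} = \int_0^1 T(f \cdot T f)\, P_n$, and $T(f \cdot T f) < L$ holds pointwise:
  Parseval gives $\leqslant$, and equality at $y$ would make $f^2 = L$ on all $L^2$ points
  $\frac{y+i}{L^2}$, too many for a trigonometric polynomial of this degree. By compactness
  $\int_0^1 P_n = O(t^n)$ with $t < \sqrt L$, and summing $P_n/s^n$ for $t < s < \sqrt L$ finishes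
  the proof.
\<close>

section \<open>Trigonometric polynomials and fibre averages\<close>

definition trig_poly :: "(nat \<Rightarrow> complex) \<Rightarrow> nat \<Rightarrow> real \<Rightarrow> complex" where
  "trig_poly c L x = (\<Sum>r<L. c r * cis (2 * pi * x) ^ r)"

text \<open>For 1-periodic \<open>g\<close> this is the transfer operator T of multiplication by L
  modulo 1: the points \<open>(y + i) / L\<close> are the preimages of \<open>y\<close>.\<close>

definition fibre_avg :: "nat \<Rightarrow> (real \<Rightarrow> real) \<Rightarrow> real \<Rightarrow> real" where
  "fibre_avg L g y = (\<Sum>i<L. g ((y + real i) / real L)) / real L"

lemma cis_2pi_eq_1_imp_Ints:
  assumes "cis (2 * pi * x) = 1"
  shows "x \<in> \<int>"
proof -
  have "cos (2 * pi * x) = 1"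
    using assms by (metis cis.sel(1) one_complex.sel(1))
  then obtain n :: int where "2 * pi * x = of_int n * 2 * pi"
    by (auto simp: cos_one_2pi_int)
  then have "x = of_int n" by simp
  then show ?thesis by simp
qed

lemma cis_2pi_of_nat [simp]: "cis (2 * pi * real n) = 1"
  by (rule cis_multiple_2pi) simp

lemma cis_2pi_add_of_nat: "cis (2 * pi * (x + real n)) = cis (2 * pi * x)"
  by (simp add: distrib_left flip: cis_mult)

lemma cis_2pi_divide_power:
  assumes "L > 0"
  shows "cis (2 * pi * (x / real L)) ^ L = cis (2 * pi * x)"
proof -
  have "real L * (2 * pi * (x / real L)) = 2 * pi * x"
    using assms by simp
  then show ?thesis by (simp only: Complex.DeMoivre)
qed

lemma trig_poly_add_of_nat: "trig_poly c L (x + real n) = trig_poly c L x"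
  by (simp add: trig_poly_def cis_2pi_add_of_nat)

lemma continuous_on_trig_poly [continuous_intros]:
  assumes "continuous_on S g"
  shows "continuous_on S (\<lambda>x. trig_poly c L (g x))"
  unfolding trig_poly_def by (intro continuous_intros assms)

lemma norm_trig_poly_le:
  assumes "\<And>r. r < L \<Longrightarrow> norm (c r) \<le> 1"
  shows "norm (trig_poly c L x) \<le> real L"
proof -
  have "norm (trig_poly c L x) \<le> (\<Sum>r<L. norm (c r * cis (2 * pi * x) ^ r))"
    unfolding trig_poly_def by (rule norm_sum)
  also have "\<dots> \<le> (\<Sum>r<L. 1)"
    using assms by (intro sum_mono) (simp add: norm_mult norm_power)
  finally show ?thesis by simp
qed

section \<open>Parseval's identity on a single fibre\<close>

text \<open>The i-th summand is a constant times \<open>q ^ i\<close> with an L-th root of unity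
  \<open>q\<close>, which differs from 1 because 0 < |r - s| < L. So the geometric sum
  vanishes.\<close>

lemma sum_fibre_orthogonal:
  assumes "r < L" "s < L" "r \<noteq> s"
  shows "(\<Sum>i<L. cis (2 * pi * ((y + real i) / real L)) ^ r *
            cnj (cis (2 * pi * ((y + real i) / real L)) ^ s)) = 0"
proof -
  define \<alpha> where "\<alpha> = cis (2 * pi * (y / real L) * (real r - real s))"
  define q where "q = cis (2 * pi * ((real r - real s) / real L))"
  have L: "real L > 0" using assms by simp
  have "cis (2 * pi * ((y + real i) / real L)) ^ r *
            cnj (cis (2 * pi * ((y + real i) / real L)) ^ s) = \<alpha> * q ^ i" for i
    unfolding \<alpha>_def q_def
    by (simp add: Complex.DeMoivre cis_cnj cis_mult)
      (simp add: add_divide_distrib diff_divide_distrib algebra_simps)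
  moreover have "q \<noteq> 1"
  proof
    assume "q = 1"
    then have "(real r - real s) / real L \<in> \<int>"
      unfolding q_def by (rule cis_2pi_eq_1_imp_Ints)
    then obtain n :: int where n: "(real r - real s) / real L = of_int n"
      by (auto elim: Ints_cases)
    have "\<bar>(real r - real s) / real L\<bar> < 1"
      using assms L by (simp add: field_simps abs_if)
    then have "n = 0" using n by linarith
    then show False using n assms by simp
  qed
  moreover have "q ^ L = 1"
  proof -
    have "q ^ L = cis (2 * pi * real r - 2 * pi * real s)"
      using assms by (simp add: q_def cis_2pi_divide_power flip: right_diff_distrib del: times_divide_eq_right)
    also have "\<dots> = 1" by (simp flip: cis_divide)
    finally show ?thesis .
  qed
  ultimately show ?thesis
    by (simp add: geometric_sum flip: sum_distrib_left)
qed

text \<open>Distinct frequencies below L stay distinct modulo L, so the cross terms cancel on each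
  fibre, not only after integration over \<open>y\<close>.\<close>

lemma sum_fibre_norm_trig_poly:
  "(\<Sum>i<L. (norm (trig_poly c L ((y + real i) / real L)))\<^sup>2) = real L * (\<Sum>r<L. (norm (c r))\<^sup>2)"
proof -
  let ?w = "\<lambda>i. cis (2 * pi * ((y + real i) / real L))"
  have "complex_of_real (\<Sum>i<L. (norm (trig_poly c L ((y + real i) / real L)))\<^sup>2)
      = (\<Sum>i<L. \<Sum>r<L. \<Sum>s<L. c r * cnj (c s) * (?w i ^ r * cnj (?w i ^ s)))"
    by (simp add: trig_poly_def complex_norm_square sum_product mult_ac flip: of_real_power)
  also have "\<dots> = (\<Sum>r<L. \<Sum>s<L. c r * cnj (c s) * (\<Sum>i<L. ?w i ^ r * cnj (?w i ^ s)))"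
    unfolding sum_distrib_left
    by (subst (2) sum.swap[where A = "{..<L}" and B = "{..<L}"], subst sum.swap) (rule refl)
  also have "\<dots> = (\<Sum>r<L. \<Sum>s<L. if s = r then c r * cnj (c r) * of_nat L else 0)"
  proof (intro sum.cong refl)
    fix r s assume "r \<in> {..<L}" "s \<in> {..<L}"
    moreover have "?w i ^ r * cnj (?w i ^ r) = 1" for i
      by (simp add: complex_norm_square[symmetric] norm_power del: complex_cnj_power)
    ultimately show "c r * cnj (c s) * (\<Sum>i<L. ?w i ^ r * cnj (?w i ^ s))
        = (if s = r then c r * cnj (c r) * of_nat L else 0)"
      using sum_fibre_orthogonal[of r L s y] by (auto simp del: complex_cnj_power)
  qed
  also have "\<dots> = complex_of_real (real L * (\<Sum>r<L. (norm (c r))\<^sup>2))"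
    by (simp add: complex_norm_square sum_distrib_left mult_ac flip: of_real_power)
  finally show ?thesis by (simp only: of_real_eq_iff)
qed

text \<open>Parseval evaluates the quadratic part of the expanded square and leaves the fibre
  average as the only unknown. Nonnegativity of the left side bounds this average; its vanishing
  settles the case of equality.\<close>

lemma fibre_avg_deviation:
  assumes "L > 0"
  shows "(\<Sum>i<L. (norm (trig_poly c L ((y + real i) / real L)) - sqrt (real L))\<^sup>2)
           = real L * ((\<Sum>r<L. (norm (c r))\<^sup>2) + real L
               - 2 * sqrt (real L) * fibre_avg L (\<lambda>x. norm (trig_poly c L x)) y)"
proof -
  have "(\<Sum>i<L. (norm (trig_poly c L ((y + real i) / real L)) - sqrt (real L))\<^sup>2)
      = (\<Sum>i<L. (norm (trig_poly c L ((y + real i) / real L)))\<^sup>2) + real L * real L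
          - 2 * sqrt (real L) * (\<Sum>i<L. norm (trig_poly c L ((y + real i) / real L)))"
    by (simp add: power2_diff sum.distrib sum_subtractf sum_distrib_left mult_ac)
  also have "(\<Sum>i<L. norm (trig_poly c L ((y + real i) / real L)))
      = real L * fibre_avg L (\<lambda>x. norm (trig_poly c L x)) y"
    using assms by (simp add: fibre_avg_def)
  finally show ?thesis
    by (simp add: sum_fibre_norm_trig_poly algebra_simps)
qed

lemma sum_norm_coeff_le:
  assumes "\<And>r. r < L \<Longrightarrow> norm (c r :: complex) \<le> 1"
  shows "(\<Sum>r<L. (norm (c r))\<^sup>2) \<le> real L"
  using sum_bounded_above[of "{..<L}" "\<lambda>r. (norm (c r))\<^sup>2" 1] assms
  by (simp add: power_le_one)

lemma fibre_avg_norm_trig_poly_le: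
  assumes "\<And>r. r < L \<Longrightarrow> norm (c r) \<le> 1" and "L > 0"
  shows "fibre_avg L (\<lambda>x. norm (trig_poly c L x)) y \<le> sqrt (real L)"
proof -
  let ?T = "fibre_avg L (\<lambda>x. norm (trig_poly c L x)) y"
  have "0 \<le> real L * ((\<Sum>r<L. (norm (c r))\<^sup>2) + real L - 2 * sqrt (real L) * ?T)"
    by (subst fibre_avg_deviation[OF assms(2), symmetric]) (auto intro: sum_nonneg)
  then have "2 * sqrt (real L) * ?T \<le> 2 * real L"
    using sum_norm_coeff_le[of L c, OF assms(1)] assms(2) by (simp add: zero_le_mult_iff)
  then have "sqrt (real L) * ?T \<le> sqrt (real L) * sqrt (real L)" by simp
  then show ?thesis using assms(2) by (simp del: real_sqrt_mult_self)
qed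

lemma fibre_avg_norm_trig_poly_eq:
  assumes "\<And>r. r < L \<Longrightarrow> norm (c r) \<le> 1" and "L > 0"
    and "fibre_avg L (\<lambda>x. norm (trig_poly c L x)) y \<ge> sqrt (real L)" and "i < L"
  shows "norm (trig_poly c L ((y + real i) / real L)) = sqrt (real L)"
proof -
  let ?T = "fibre_avg L (\<lambda>x. norm (trig_poly c L x)) y"
  have "sqrt (real L) * sqrt (real L) \<le> sqrt (real L) * ?T"
    using assms by (intro mult_left_mono) auto
  then have "(\<Sum>r<L. (norm (c r))\<^sup>2) + real L - 2 * sqrt (real L) * ?T \<le> 0"
    using sum_norm_coeff_le[of L c, OF assms(1)] by simp
  then have "(\<Sum>i<L. (norm (trig_poly c L ((y + real i) / real L)) - sqrt (real L))\<^sup>2) \<le> 0"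
    by (subst fibre_avg_deviation[OF assms(2)]) (simp_all add: mult_nonneg_nonpos)
  moreover have "\<forall>i\<in>{..<L}. 0 \<le> (norm (trig_poly c L ((y + real i) / real L)) - sqrt (real L))\<^sup>2"
    by simp
  ultimately have "(norm (trig_poly c L ((y + real i) / real L)) - sqrt (real L))\<^sup>2 = 0"
    using assms(4) by (metis (no_types, lifting) finite_lessThan lessThan_iff order_antisym sum_nonneg sum_nonneg_eq_0_iff)
  then show ?thesis by simp
qed

section \<open>Strictness of the bound after two averaging steps\<close>

text \<open>Counting: the L fibre points give pairwise distinct roots of
  \<open>z ^ L = cis (2 * pi * y)\<close>, and this equation has exactly L roots.\<close>

lemma ex_fibre_point:
  assumes "z ^ L = cis (2 * pi * y)" and "L > 0"
  shows "\<exists>i<L. z = cis (2 * pi * ((y + real i) / real L))"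
proof -
  let ?e = "\<lambda>i. cis (2 * pi * ((y + real i) / real L))"
  have "inj_on ?e {..<L}"
  proof (rule inj_onI)
    fix i j assume ij: "i \<in> {..<L}" "j \<in> {..<L}" "?e i = ?e j"
    have "cis (2 * pi * ((real i - real j) / real L)) = ?e i / ?e j"
      by (simp only: cis_divide) (simp add: field_simps add_divide_distrib diff_divide_distrib)
    also have "\<dots> = 1" using ij(3) by simp
    finally have "(real i - real j) / real L \<in> \<int>" by (rule cis_2pi_eq_1_imp_Ints)
    then obtain n :: int where n: "(real i - real j) / real L = of_int n"
      by (auto elim: Ints_cases)
    have "\<bar>(real i - real j) / real L\<bar> < 1"
      using ij assms(2) by (simp add: field_simps abs_if)
    then have "n = 0" using n by linarith
    then show "i = j" using n assms(2) by simp
  qed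
  then have "card (?e ` {..<L}) = L" by (simp add: card_image)
  moreover have "?e ` {..<L} \<subseteq> {z. z ^ L = cis (2 * pi * y)}"
  proof clarify
    fix i
    show "?e i ^ L = cis (2 * pi * y)"
      using assms(2) by (simp only: cis_2pi_divide_power cis_2pi_add_of_nat)
  qed
  moreover have "card {z. z ^ L = cis (2 * pi * y)} = L"
    using assms(2) by (simp add: card_nth_roots)
  moreover have "finite {z. z ^ L = cis (2 * pi * y)}"
    using assms(2) by (simp add: finite_nth_roots)
  ultimately have "?e ` {..<L} = {z. z ^ L = cis (2 * pi * y)}"
    by (metis card_subset_eq)
  then show ?thesis using assms(1) by blast
qed

text \<open>
  On the unit circle \<open>u ^ (L - 1) * (norm (\<Sum>r<L. c r * u ^ r))\<^sup>2\<close> is a polynomial in \<open>u\<close> of degree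
  at most \<open>2 * L - 2\<close>, which cannot agree with \<open>L * u ^ (L - 1)\<close> at \<open>L * L\<close> points.
\<close>
lemma trig_poly_not_flat:
  fixes c :: "nat \<Rightarrow> complex"
  assumes "c 0 \<noteq> 0" "c (L - 1) \<noteq> 0" and L: "L \<ge> 2" and "norm w = 1"
  shows "\<exists>u. u ^ (L * L) = w \<and> (norm (\<Sum>r<L. c r * u ^ r))\<^sup>2 \<noteq> real L"
proof (rule ccontr)
  assume "\<not> ?thesis"
  then have flat: "(norm (\<Sum>r<L. c r * u ^ r))\<^sup>2 = real L" if "u ^ (L * L) = w" for u
    using that by blast
  define q where "q = (\<Sum>r<L. \<Sum>s<L. monom (c r * cnj (c s)) (r + (L - 1 - s)))
    - monom (of_nat L) (L - 1)"
  have "poly q u = 0" if u: "u ^ (L * L) = w" for u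
  proof -
    have "norm u ^ (L * L) = 1"
      using u \<open>norm w = 1\<close> by (metis norm_power)
    then have "norm u = 1"
      using L by (metis norm_ge_zero power_eq_1_iff mult_eq_0_iff not_numeral_le_zero real_norm_def abs_norm_cancel)
    then have cu: "u ^ (L - 1 - s) = u ^ (L - 1) * cnj (u ^ s)" if "s < L" for s
    proof -
      have "u ^ (L - 1) * cnj (u ^ s) = u ^ (L - 1 - s) * (u ^ s * cnj (u ^ s))"
        using that by (simp add: mult.assoc[symmetric] flip: power_add)
      also have "u ^ s * cnj (u ^ s) = 1"
        using \<open>norm u = 1\<close> by (simp add: norm_power complex_norm_square[symmetric] del: complex_cnj_power)
      finally show ?thesis by simp
    qed
    have "(\<Sum>r<L. \<Sum>s<L. c r * cnj (c s) * u ^ (r + (L - 1 - s)))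
        = (\<Sum>r<L. \<Sum>s<L. (c r * u ^ r) * cnj (c s * u ^ s) * u ^ (L - 1))"
      by (intro sum.cong refl) (simp only: power_add cu lessThan_iff complex_cnj_mult mult_ac)
    also have "\<dots> = (\<Sum>r<L. c r * u ^ r) * cnj (\<Sum>s<L. c s * u ^ s) * u ^ (L - 1)"
      by (simp only: cnj_sum sum_product) (simp only: sum_distrib_right)
    also have "\<dots> = of_nat L * u ^ (L - 1)"
      using flat[OF u] by (simp add: complex_norm_square[symmetric] del: cnj_sum of_real_power)
    finally show ?thesis
      by (simp add: q_def poly_sum poly_monom)
  qed
  then have roots: "{u. u ^ (L * L) = w} \<subseteq> {u. poly q u = 0}" by blast
  \<comment> \<open>Only \<open>r = L - 1\<close>, \<open>s = 0\<close> reaches the exponent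
    \<open>2 * L - 2\<close>, and the subtracted monomial lies below it because
    \<open>L \<ge> 2\<close>. Nonzero end coefficients therefore make \<open>q\<close>
    nonzero.\<close>
  have "coeff q (2 * L - 2) = (\<Sum>r<L. \<Sum>s<L. if r = L - 1 \<and> s = 0 then c r * cnj (c s) else 0)"
  proof -
    have "(r + (L - 1 - s) = 2 * L - 2) = (r = L - 1 \<and> s = 0)" if "r < L" "s < L" for r s
      using that by auto
    moreover have "L - 1 \<noteq> 2 * L - 2" using L by simp
    ultimately show ?thesis
      by (simp add: q_def coeff_sum)
  qed
  also have "\<dots> = (\<Sum>r<L. if r = L - 1 then \<Sum>s<L. if s = 0 then c r * cnj (c s) else 0 else 0)"
    by (intro sum.cong refl) auto
  also have "\<dots> = c (L - 1) * cnj (c 0)"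
    using L by (simp add: sum.delta)
  finally have "q \<noteq> 0" using assms(1,2) by auto
  have "degree q \<le> 2 * L - 2"
    unfolding q_def
    by (intro degree_diff_le degree_sum_le finite_lessThan order.trans[OF degree_monom_le]) auto
  have "L * L = card {u. u ^ (L * L) = w}"
    using L \<open>norm w = 1\<close> by (subst card_nth_roots) auto
  also have "\<dots> \<le> card {u. poly q u = 0}"
    using roots \<open>q \<noteq> 0\<close> by (intro card_mono poly_roots_finite)
  also have "\<dots> \<le> degree q"
    using \<open>q \<noteq> 0\<close> by (rule card_poly_roots_bound)
  also have "\<dots> \<le> 2 * L - 2" by fact
  also have "\<dots> < 2 * L" using L by simp
  also have "\<dots> \<le> L * L" using L by simp
  finally show False by simp
qed

lemma fibre_avg_mono:
  assumes "\<And>x. g x \<le> h x"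
  shows "fibre_avg L g y \<le> fibre_avg L h y"
  unfolding fibre_avg_def by (intro divide_right_mono sum_mono assms) simp

text \<open>A single average can attain sqrt L: for L = 2 and both coefficients 1 it does so at y =
  1/2. Equality after two steps would make \<open>f\<close> equal to sqrt L on the L^2 points of the
  second fibre, which \<open>trig_poly_not_flat\<close> excludes.\<close>

lemma fibre_avg_two_steps_less:
  fixes c :: "nat \<Rightarrow> complex" and L :: nat
  defines "f \<equiv> \<lambda>x. norm (trig_poly c L x)"
  assumes c: "\<And>r. r < L \<Longrightarrow> norm (c r) \<le> 1" and L: "L \<ge> 2"
  shows "fibre_avg L (\<lambda>x. f x * fibre_avg L f x) y < real L"
proof (rule ccontr)
  assume "\<not> ?thesis"
  then have ge: "fibre_avg L (\<lambda>x. f x * fibre_avg L f x) y \<ge> sqrt (real L) * sqrt (real L)"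
    by simp
  have L0: "L > 0" using L by simp
  have T: "fibre_avg L f x \<le> sqrt (real L)" for x
    unfolding f_def by (rule fibre_avg_norm_trig_poly_le[OF c L0])
  have "fibre_avg L (\<lambda>x. f x * fibre_avg L f x) y \<le> fibre_avg L (\<lambda>x. f x * sqrt (real L)) y"
    by (intro fibre_avg_mono mult_left_mono T) (simp add: f_def)
  also have "\<dots> = fibre_avg L f y * sqrt (real L)"
    by (simp add: fibre_avg_def flip: sum_distrib_right)
  finally have "sqrt (real L) * sqrt (real L) \<le> fibre_avg L f y * sqrt (real L)"
    using ge by linarith
  then have "sqrt (real L) \<le> fibre_avg L f y"
    using L0 by (simp del: real_sqrt_mult_self)
  then have f1: "f ((y + real i) / real L) = sqrt (real L)" if "i < L" for i
    using fibre_avg_norm_trig_poly_eq[OF c L0 _ that] by (simp add: f_def)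
  \<comment> \<open>With \<open>f\<close> equal to sqrt L on the first fibre, the outer average is
    sqrt L times a mean of numbers that are at most sqrt L; one smaller number would push it below
    L.\<close>
  have f2: "fibre_avg L f ((y + real i) / real L) \<ge> sqrt (real L)" if "i < L" for i
  proof (rule ccontr)
    assume less: "\<not> ?thesis"
    have "(\<Sum>j<L. sqrt (real L) * fibre_avg L f ((y + real j) / real L))
        < (\<Sum>j<L. sqrt (real L) * sqrt (real L))"
    proof (rule sum_strict_mono_ex1)
      show "\<forall>j\<in>{..<L}. sqrt (real L) * fibre_avg L f ((y + real j) / real L)
          \<le> sqrt (real L) * sqrt (real L)"
        using T by (intro ballI mult_left_mono) auto
      show "\<exists>j\<in>{..<L}. sqrt (real L) * fibre_avg L f ((y + real j) / real L)
          < sqrt (real L) * sqrt (real L)"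
        using less that L0 by (intro bexI[of _ i] mult_strict_left_mono) auto
    qed simp
    moreover have "(\<Sum>j<L. sqrt (real L) * fibre_avg L f ((y + real j) / real L))
        = real L * fibre_avg L (\<lambda>x. f x * fibre_avg L f x) y"
      using L0 f1 by (subst (2) fibre_avg_def) simp
    ultimately have "real L * fibre_avg L (\<lambda>x. f x * fibre_avg L f x) y < real L * real L"
      using L0 by simp
    then show False using ge L0 by simp
  qed
  have f3: "f (((y + real i) / real L + real j) / real L) = sqrt (real L)" if "i < L" "j < L" for i j
    using fibre_avg_norm_trig_poly_eq[OF c L0 _ that(2)] f2[OF that(1)] by (simp add: f_def)
  \<comment> \<open>Applying \<open>ex_fibre_point\<close> twice identifies every \<open>u\<close>
    with a point of the second fibre.\<close>
  have flat: "norm (\<Sum>r<L. c r * u ^ r) = sqrt (real L)" if u: "u ^ (L * L) = cis (2 * pi * y)" for u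
  proof -
    have "(u ^ L) ^ L = cis (2 * pi * y)" using u by (simp add: power_mult)
    then obtain i where i: "i < L" "u ^ L = cis (2 * pi * ((y + real i) / real L))"
      using ex_fibre_point L0 by blast
    then obtain j where "j < L" "u = cis (2 * pi * (((y + real i) / real L + real j) / real L))"
      using ex_fibre_point L0 by blast
    with f3[OF i(1)] show ?thesis by (simp add: f_def trig_poly_def)
  qed
  \<comment> \<open>Parseval on the first fibre leaves no slack in the bounds
    \<open>norm (c r) \<le> 1\<close>, so no coefficient vanishes, in particular neither end
    coefficient.\<close>
  have "real L * (\<Sum>r<L. (norm (c r))\<^sup>2) = (\<Sum>i<L. (f ((y + real i) / real L))\<^sup>2)"
    unfolding f_def by (rule sum_fibre_norm_trig_poly[symmetric])
  also have "\<dots> = real L * real L" using f1 by simp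
  finally have sum_c: "(\<Sum>r<L. (norm (c r))\<^sup>2) = real L" using L0 by simp
  have "c r \<noteq> 0" if "r < L" for r
  proof
    assume "c r = 0"
    then have "(\<Sum>r<L. (norm (c r))\<^sup>2) < (\<Sum>r<L. 1)"
      using c that by (intro sum_strict_mono_ex1) (auto simp: power_le_one intro!: bexI[of _ r])
    then show False using sum_c by simp
  qed
  then have "c 0 \<noteq> 0" "c (L - 1) \<noteq> 0" using L by auto
  from trig_poly_not_flat[of c L "cis (2 * pi * y)", OF this L] flat show False
    by fastforce
qed

section \<open>Almost sure bounds for products along an orbit\<close>

text \<open>T preserves integrals over a period: cut [0,1) into the intervals \<open>J i\<close> of
  length 1/L and substitute x = (y + i) / L in each.\<close>

lemma nn_integral_fibre_avg:
  fixes g :: "real \<Rightarrow> real"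
  assumes [measurable]: "g \<in> borel_measurable borel" and g: "\<And>x. g x \<ge> 0" and L: "L > 0"
  shows "(\<integral>\<^sup>+x. ennreal (g x) * indicator {0..<1} x \<partial>lborel)
       = (\<integral>\<^sup>+y. ennreal (fibre_avg L g y) * indicator {0..<1} y \<partial>lborel)"
proof -
  define J where "J i = {real i / real L ..< real (Suc i) / real L}" for i
  have J_meas [measurable]: "J i \<in> sets borel" for i unfolding J_def by simp
  have part: "(\<integral>\<^sup>+x. ennreal (g x) * indicator (J i) x \<partial>lborel)
      = (\<integral>\<^sup>+y. ennreal (g ((y + real i) / real L) / real L) * indicator {0..<1} y \<partial>lborel)" for i
  proof -
    have "(\<integral>\<^sup>+x. ennreal (g x) * indicator (J i) x \<partial>lborel)
        = ennreal (1 / real L) * (\<integral>\<^sup>+y. ennreal (g (real i / real L + 1 / real L * y))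
            * indicator (J i) (real i / real L + 1 / real L * y) \<partial>lborel)"
      using L by (subst nn_integral_real_affine[where c = "1 / real L" and t = "real i / real L"]) auto
    also have "\<dots> = (\<integral>\<^sup>+y. ennreal (1 / real L) * (ennreal (g (real i / real L + 1 / real L * y))
            * indicator (J i) (real i / real L + 1 / real L * y)) \<partial>lborel)"
      by (subst nn_integral_cmult) auto
    also have "\<dots> = (\<integral>\<^sup>+y. ennreal (g ((y + real i) / real L) / real L) * indicator {0..<1} y \<partial>lborel)"
    proof (intro nn_integral_cong)
      fix y :: real
      have eq: "real i / real L + 1 / real L * y = (y + real i) / real L"
        by (simp add: add_divide_distrib)
      have "(y + real i) / real L \<in> J i \<longleftrightarrow> y \<in> {0..<1}"
        using L by (auto simp: J_def divide_simps)
      then have ind: "indicator (J i) ((y + real i) / real L) = (indicator {0..<1} y :: ennreal)"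
        by (simp add: indicator_def)
      show "ennreal (1 / real L) * (ennreal (g (real i / real L + 1 / real L * y))
            * indicator (J i) (real i / real L + 1 / real L * y))
          = ennreal (g ((y + real i) / real L) / real L) * indicator {0..<1} y"
        unfolding eq ind using g by (simp add: mult.assoc[symmetric] flip: ennreal_mult)
    qed
    finally show ?thesis .
  qed
  have ind: "(\<Sum>i<m. indicator (J i) x) = (indicator {0..<real m / real L} x :: ennreal)" for m x
  proof (induction m)
    case (Suc m)
    have "real m / real L \<le> real (Suc m) / real L" and "0 \<le> real m / real L"
      by (auto intro!: divide_right_mono)
    then have "x \<in> {0..<real (Suc m) / real L} \<longleftrightarrow> x \<in> {0..<real m / real L} \<or> x \<in> J m"
      and "\<not> (x \<in> {0..<real m / real L} \<and> x \<in> J m)"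
      unfolding J_def atLeastLessThan_iff by linarith+
    then have "indicator {0..<real m / real L} x + indicator (J m) x
        = (indicator {0..<real (Suc m) / real L} x :: ennreal)"
      unfolding indicator_def by auto
    with Suc.IH show ?case by simp
  qed simp
  have "(\<integral>\<^sup>+x. ennreal (g x) * indicator {0..<1} x \<partial>lborel)
      = (\<integral>\<^sup>+x. (\<Sum>i<L. ennreal (g x) * indicator (J i) x) \<partial>lborel)"
    using L by (simp add: ind flip: sum_distrib_left)
  also have "\<dots> = (\<Sum>i<L. \<integral>\<^sup>+x. ennreal (g x) * indicator (J i) x \<partial>lborel)"
    by (rule nn_integral_sum) measurable
  also have "\<dots> = (\<integral>\<^sup>+y. (\<Sum>i<L. ennreal (g ((y + real i) / real L) / real L) * indicator {0..<1} y) \<partial>lborel)"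
    unfolding part by (rule nn_integral_sum[symmetric]) measurable
  also have "\<dots> = (\<integral>\<^sup>+y. ennreal (fibre_avg L g y) * indicator {0..<1} y \<partial>lborel)"
    using g by (simp add: fibre_avg_def sum_divide_distrib flip: sum_distrib_right)
  finally show ?thesis .
qed

text \<open>On the fibre of \<open>y\<close> the argument of \<open>H\<close> runs through the
  points \<open>y + i\<close>, so by periodicity \<open>H y\<close> leaves the average. This strips
  factors off the orbit product.\<close>

lemma fibre_avg_mult_periodic:
  assumes H: "\<And>x n. H (x + real n) = H x" and L: "L > 0"
  shows "fibre_avg L (\<lambda>x. g x * H (real L * x)) y = fibre_avg L g y * H y"
  using L H by (simp add: fibre_avg_def sum_distrib_right)

lemma borel_measurable_fibre_avg [measurable]:
  assumes [measurable]: "g \<in> borel_measurable borel"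
  shows "fibre_avg L g \<in> borel_measurable borel"
  unfolding fibre_avg_def by measurable

lemma continuous_on_fibre_avg:
  assumes "continuous_on UNIV g"
  shows "continuous_on UNIV (fibre_avg L g)"
  unfolding fibre_avg_def divide_inverse
  by (intro continuous_intros continuous_on_compose2[OF assms]) auto

lemma fibre_avg_nonneg:
  assumes "\<And>x. g x \<ge> 0"
  shows "fibre_avg L g y \<ge> 0"
  unfolding fibre_avg_def by (intro divide_nonneg_nonneg sum_nonneg assms) simp

text \<open>Two rounds of averaging replace the first two factors of \<open>X (n + 2)\<close> by
  \<open>F\<close>, leaving \<open>F * X n\<close>. The maximum of \<open>F\<close> over a period is
  below L, so on average each factor costs less than sqrt L.\<close>

lemma nn_integral_prod_trig_poly_le:
  fixes c :: "nat \<Rightarrow> complex" and L :: nat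
  defines "X \<equiv> \<lambda>n x. \<Prod>j<n. norm (trig_poly c L (real L ^ j * x))"
  assumes c: "\<And>r. r < L \<Longrightarrow> norm (c r) \<le> 1" and L: "L \<ge> 2"
  shows "\<exists>t. 1 \<le> t \<and> t < sqrt (real L) \<and>
    (\<forall>n. (\<integral>\<^sup>+x. ennreal (X n x) * indicator {0..<1} x \<partial>lborel) \<le> ennreal (real L * t ^ n))"
proof -
  define f where "f = (\<lambda>x. norm (trig_poly c L x))"
  define F where "F = fibre_avg L (\<lambda>x. f x * fibre_avg L f x)"
  have L0: "L > 0" using L by simp
  have f0: "f x \<ge> 0" for x by (simp add: f_def)
  have f_cont: "continuous_on UNIV f"
    unfolding f_def by (intro continuous_intros)
  then have [measurable]: "f \<in> borel_measurable borel"
    by (rule borel_measurable_continuous_onI)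
  have f_per: "f (x + real n) = f x" for x n
    by (simp add: f_def trig_poly_add_of_nat)
  have X_eq: "X n x = (\<Prod>j<n. f (real L ^ j * x))" for n x
    by (simp add: X_def f_def)
  have X0: "X n x \<ge> 0" for n x
    unfolding X_eq by (intro prod_nonneg) (simp add: f0)
  have [measurable]: "X n \<in> borel_measurable borel" for n
    unfolding X_eq by measurable
  have X_Suc: "X (Suc n) x = f x * X n (real L * x)" for n x
    unfolding X_eq prod.lessThan_Suc_shift by (simp add: mult_ac)
  have X_per: "X n (x + real m) = X n x" for n x m
  proof -
    have "real L ^ j * (x + real m) = real L ^ j * x + real (L ^ j * m)" for j
      by (simp add: distrib_left)
    then show ?thesis unfolding X_eq by (simp only: f_per)
  qed
  have F_cont: "continuous_on UNIV F"
    unfolding F_def by (intro continuous_on_fibre_avg continuous_on_mult f_cont)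
  have F_nonneg: "F x \<ge> 0" for x
    unfolding F_def by (intro fibre_avg_nonneg mult_nonneg_nonneg f0)
  have "\<exists>x0\<in>{0..1}. \<forall>x\<in>{0..1}. F x \<le> F x0"
    by (intro continuous_attains_sup continuous_on_subset[OF F_cont]) auto
  then obtain x0 where x0: "\<And>x. x \<in> {0..1} \<Longrightarrow> F x \<le> F x0"
    by blast
  \<comment> \<open>\<open>F\<close> accounts for two factors at once, hence the square root; the
    maximum with 1 gives \<open>t \<ge> 1\<close>, which the base case n = 1 below uses.\<close>
  define t where "t = sqrt (max 1 (F x0))"
  have "F x0 < real L"
    unfolding F_def f_def using c L by (rule fibre_avg_two_steps_less)
  then have t: "1 \<le> t" "t < sqrt (real L)"
    unfolding t_def using L by auto
  have t2: "F x \<le> t\<^sup>2" if "x \<in> {0..<1}" for x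
    using x0[of x] that by (auto simp: t_def max_def)
  define I where "I n = (\<integral>\<^sup>+x. ennreal (X n x) * indicator {0..<1} x \<partial>lborel)" for n
  have step: "I (Suc (Suc n)) \<le> ennreal (t\<^sup>2) * I n" for n
  proof -
    have "I (Suc (Suc n)) = (\<integral>\<^sup>+y. ennreal (fibre_avg L (X (Suc (Suc n))) y) * indicator {0..<1} y \<partial>lborel)"
      unfolding I_def using X0 L0 by (intro nn_integral_fibre_avg) auto
    also have "fibre_avg L (X (Suc (Suc n))) = (\<lambda>y. fibre_avg L f y * X (Suc n) y)"
      using fibre_avg_mult_periodic[of "X (Suc n)" L f] X_per L0 by (subst X_Suc[abs_def]) auto
    also have "(\<integral>\<^sup>+y. ennreal (fibre_avg L f y * X (Suc n) y) * indicator {0..<1} y \<partial>lborel)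
        = (\<integral>\<^sup>+y. ennreal (fibre_avg L (\<lambda>y. fibre_avg L f y * X (Suc n) y) y) * indicator {0..<1} y \<partial>lborel)"
      using X0 L0 f0 by (intro nn_integral_fibre_avg) (auto intro!: mult_nonneg_nonneg fibre_avg_nonneg)
    also have "fibre_avg L (\<lambda>y. fibre_avg L f y * X (Suc n) y) = (\<lambda>y. F y * X n y)"
      using fibre_avg_mult_periodic[of "X n" L "\<lambda>x. f x * fibre_avg L f x"] X_per L0
      by (subst X_Suc[abs_def]) (auto simp: F_def mult_ac)
    also have "(\<integral>\<^sup>+y. ennreal (F y * X n y) * indicator {0..<1} y \<partial>lborel)
        \<le> (\<integral>\<^sup>+y. ennreal (t\<^sup>2) * (ennreal (X n y) * indicator {0..<1} y) \<partial>lborel)"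
    proof (intro nn_integral_mono)
      fix y :: real
      show "ennreal (F y * X n y) * indicator {0..<1} y
          \<le> ennreal (t\<^sup>2) * (ennreal (X n y) * indicator {0..<1} y)"
        using t2[of y] X0[of n y]
        by (auto simp: indicator_def intro!: ennreal_leI mult_right_mono simp flip: ennreal_mult)
    qed
    also have "\<dots> = ennreal (t\<^sup>2) * I n"
      unfolding I_def by (rule nn_integral_cmult) measurable
    finally show ?thesis .
  qed
  have X_le: "I n \<le> ennreal (real L ^ n)" for n
  proof -
    have "I n \<le> (\<integral>\<^sup>+x. ennreal (real L ^ n) * indicator {0..<1::real} x \<partial>lborel)"
      unfolding I_def
    proof (intro nn_integral_mono mult_right_mono ennreal_leI)
      fix x
      have "X n x \<le> (\<Prod>j<n. real L)"
        unfolding X_def using norm_trig_poly_le[OF c] by (intro prod_mono) auto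
      then show "X n x \<le> real L ^ n" by simp
    qed simp
    then show ?thesis by (simp add: nn_integral_cmult)
  qed
  \<comment> \<open>The induction advances by two. The crude bound \<open>X_le\<close> serves n = 0
    and n = 1, at the price of the factor \<open>real L\<close>.\<close>
  have "I n \<le> ennreal (real L * t ^ n)" for n
  proof (induction n rule: induct_nat_012)
    case 0
    then show ?case using X_le[of 0] L by (auto elim: order.trans)
  next
    case 1
    have "real L * 1 \<le> real L * t ^ Suc 0" using t by (intro mult_left_mono) auto
    then show ?case using X_le[of "Suc 0"] by (auto elim!: order.trans intro!: ennreal_leI)
  next
    case (ge2 n)
    have "I (Suc (Suc n)) \<le> ennreal (t\<^sup>2) * ennreal (real L * t ^ n)"
      using step[of n] ge2(1) by (auto elim!: order.trans intro!: mult_left_mono)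
    also have "\<dots> = ennreal (real L * t ^ Suc (Suc n))"
      using t by (simp add: power2_eq_square mult_ac flip: ennreal_mult)
    finally show ?case .
  qed
  then show ?thesis using t unfolding I_def by blast
qed

section \<open>From integrals over a period to almost every real point\<close>

text \<open>Integer translates of a null set are null and there are countably many of them;
  subtracting the floor moves any point into [0,1).\<close>

lemma AE_lborel_periodic:
  fixes P :: "real \<Rightarrow> bool"
  assumes ae: "AE x in lborel. x \<in> {0..<1} \<longrightarrow> P x"
    and per: "\<And>x (m::int). P (x + of_int m) \<Longrightarrow> P x"
  shows "AE x in lborel. P x"
proof -
  have "AE x in lborel. x + of_int m \<in> {0..<1} \<longrightarrow> P (x + of_int m)" for m
  proof -
    from ae obtain N where N: "N \<in> null_sets lborel" "{x. \<not> (x \<in> {0..<1} \<longrightarrow> P x)} \<subseteq> N"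
      by (auto simp: eventually_ae_filter)
    have "{x. x - (- of_int m) \<in> N} \<in> null_sets lborel"
      by (rule null_sets_translation[OF N(1)])
    then show ?thesis
      by (rule AE_I') (use N(2) in auto)
  qed
  then have "AE x in lborel. \<forall>m::int. x + of_int m \<in> {0..<1} \<longrightarrow> P (x + of_int m)"
    by (simp add: AE_all_countable)
  then show ?thesis
  proof eventually_elim
    case (elim x)
    have "x + of_int (- \<lfloor>x\<rfloor>) \<in> {0..<1}"
      by simp linarith
    then have "P (x + of_int (- \<lfloor>x\<rfloor>))" using elim by blast
    then show ?case by (rule per)
  qed
qed

lemma trig_poly_add_of_int: "trig_poly c L (x + of_int m) = trig_poly c L x"
proof -
  have "cis (2 * pi * (x + of_int m)) = cis (2 * pi * x)"
    by (simp add: distrib_left flip: cis_mult)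
  then show ?thesis by (simp add: trig_poly_def)
qed

text \<open>The series of \<open>X n / s ^ n\<close> has integral over a period at most a geometric
  series of ratio \<open>t / s < 1\<close>, so it is finite almost everywhere. Its value at the
  point serves as \<open>C\<close>, because no term exceeds the sum.\<close>

lemma AE_prod_trig_poly_le:
  fixes c :: "nat \<Rightarrow> complex" and L :: nat
  assumes c: "\<And>r. r < L \<Longrightarrow> norm (c r) \<le> 1" and L: "L \<ge> 2"
  shows "AE k in lborel. \<exists>C s. 0 < s \<and> s < sqrt (real L) \<and>
    (\<forall>n. (\<Prod>j<n. norm (trig_poly c L (real L ^ j * k))) \<le> C * s ^ n)"
proof -
  define X where "X n x = (\<Prod>j<n. norm (trig_poly c L (real L ^ j * x)))" for n x
  have X0: "X n x \<ge> 0" for n x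
    unfolding X_def by (simp add: prod_nonneg)
  have "continuous_on UNIV (X n)" for n
    unfolding X_def by (intro continuous_intros)
  then have [measurable]: "X n \<in> borel_measurable borel" for n
    by (rule borel_measurable_continuous_onI)
  have X_per: "X n (x + of_int m) = X n x" for n x m
  proof -
    have "real L ^ j * (x + of_int m) = real L ^ j * x + of_int (int L ^ j * m)" for j
      by (simp add: distrib_left)
    then show ?thesis unfolding X_def by (simp only: trig_poly_add_of_int)
  qed
  obtain t where t: "1 \<le> t" "t < sqrt (real L)"
    and int: "\<And>n. (\<integral>\<^sup>+x. ennreal (X n x) * indicator {0..<1} x \<partial>lborel) \<le> ennreal (real L * t ^ n)"
    using nn_integral_prod_trig_poly_le[of L c] c L unfolding X_def by blast
  obtain s where s: "t < s" "s < sqrt (real L)"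
    using t(2) dense by blast
  have "(\<integral>\<^sup>+x. (\<Sum>n. ennreal (1 / s ^ n) * (ennreal (X n x) * indicator {0..<1} x)) \<partial>lborel)
      = (\<Sum>n. \<integral>\<^sup>+x. ennreal (1 / s ^ n) * (ennreal (X n x) * indicator {0..<1} x) \<partial>lborel)"
    by (rule nn_integral_suminf) measurable
  also have "\<dots> = (\<Sum>n. ennreal (1 / s ^ n) * (\<integral>\<^sup>+x. ennreal (X n x) * indicator {0..<1} x \<partial>lborel))"
    by (subst nn_integral_cmult) auto
  also have "\<dots> \<le> (\<Sum>n. ennreal (real L * (t / s) ^ n))"
  proof (intro suminf_le summableI)
    fix n
    have "ennreal (1 / s ^ n) * (\<integral>\<^sup>+x. ennreal (X n x) * indicator {0..<1} x \<partial>lborel)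
        \<le> ennreal (1 / s ^ n) * ennreal (real L * t ^ n)"
      by (intro mult_left_mono int) simp
    also have "\<dots> = ennreal (real L * (t / s) ^ n)"
      using s t by (simp add: power_divide mult_ac flip: ennreal_mult)
    finally show "ennreal (1 / s ^ n) * (\<integral>\<^sup>+x. ennreal (X n x) * indicator {0..<1} x \<partial>lborel)
        \<le> ennreal (real L * (t / s) ^ n)" .
  qed
  also have "\<dots> < \<infinity>"
  proof -
    have "summable (\<lambda>n. real L * (t / s) ^ n)"
      using s t by (intro summable_mult summable_geometric) auto
    then show ?thesis
      using s t by (subst suminf_ennreal2) auto
  qed
  finally have "AE x in lborel. (\<Sum>n. ennreal (1 / s ^ n) * (ennreal (X n x) * indicator {0..<1} x)) \<noteq> \<infinity>"
    by (intro nn_integral_PInf_AE) auto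
  then have "AE x in lborel. x \<in> {0..<1} \<longrightarrow> (\<exists>C. \<forall>n. X n x \<le> C * s ^ n)"
  proof eventually_elim
    case (elim x)
    let ?S = "\<Sum>n. ennreal (1 / s ^ n) * (ennreal (X n x) * indicator {0..<1} x)"
    show ?case
    proof (intro impI exI allI)
      fix n assume x: "x \<in> {0..<1}"
      have "ennreal (X n x / s ^ n) = ennreal (1 / s ^ n) * (ennreal (X n x) * indicator {0..<1} x)"
        using x s t X0[of n x] by (simp add: ennreal_mult[symmetric])
      also have "\<dots> \<le> ?S"
        using sum_le_suminf[of "\<lambda>n. ennreal (1 / s ^ n) * (ennreal (X n x) * indicator {0..<1} x)" "{n}"]
        by simp
      also have "?S = ennreal (enn2real ?S)"
        using elim by (simp add: ennreal_enn2real_if)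
      finally have "X n x / s ^ n \<le> enn2real ?S"
        by (simp only: ennreal_le_iff[OF enn2real_nonneg])
      then show "X n x \<le> enn2real ?S * s ^ n"
        using s t by (simp add: field_simps)
    qed
  qed
  then have "AE x in lborel. \<exists>C. \<forall>n. X n x \<le> C * s ^ n"
    by (rule AE_lborel_periodic) (simp add: X_per)
  then show ?thesis
    unfolding X_def
  proof eventually_elim
    case (elim k)
    moreover have "0 < s" using s t by simp
    ultimately show ?case using s(2) by blast
  qed
qed

text \<open>The associated polynomial has finitely many roots, each hit by countably many arguments
  of \<open>cis\<close>. Rescaling by all powers of L keeps the exceptional set countable, hence
  null.\<close>

lemma AE_trig_poly_nonzero:
  assumes "r < L" "c r \<noteq> 0"
  shows "AE k in lborel. \<forall>n. trig_poly c L (real L ^ n * k) \<noteq> 0"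
proof -
  define p where "p = (\<Sum>r<L. monom (c r) r)"
  have eq: "trig_poly c L x = poly p (cis (2 * pi * x))" for x
    by (simp add: trig_poly_def p_def poly_sum poly_monom)
  have "coeff p r = c r"
    using assms(1) by (simp add: p_def coeff_sum)
  then have "p \<noteq> 0" using assms(2) by auto
  then have fin: "finite {z. poly p z = 0}" by (rule poly_roots_finite)
  have "countable {x. cis (2 * pi * x) = z}" for z
  proof (cases "\<exists>x0. cis (2 * pi * x0) = z")
    case True
    then obtain x0 where x0: "cis (2 * pi * x0) = z" by blast
    have "{x. cis (2 * pi * x) = z} \<subseteq> range (\<lambda>m::int. x0 + of_int m)"
    proof
      fix x assume "x \<in> {x. cis (2 * pi * x) = z}"
      then have "cis (2 * pi * x) / cis (2 * pi * x0) = 1" using x0 by auto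
      then have "cis (2 * pi * (x - x0)) = 1" by (simp add: cis_divide right_diff_distrib)
      then have "x - x0 \<in> \<int>" by (rule cis_2pi_eq_1_imp_Ints)
      then obtain m :: int where "x - x0 = of_int m" by (auto elim: Ints_cases)
      then show "x \<in> range (\<lambda>m::int. x0 + of_int m)" by (intro range_eqI[of _ _ m]) (simp add: algebra_simps)
    qed
    then show ?thesis by (rule countable_subset) simp
  qed simp
  then have "countable (\<Union>z\<in>{z. poly p z = 0}. {x. cis (2 * pi * x) = z})"
    using fin by (intro countable_UN) (auto intro: countable_finite)
  then have cz: "countable {x. trig_poly c L x = 0}"
    by (rule countable_subset[rotated]) (auto simp: eq)
  have "countable (\<Union>n. (\<lambda>x. x / real L ^ n) ` {x. trig_poly c L x = 0})"
    using cz by (intro countable_UN countable_image) auto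
  then have "(\<Union>n. (\<lambda>x. x / real L ^ n) ` {x. trig_poly c L x = 0}) \<in> null_sets lborel"
    by (rule countable_imp_null_set_lborel)
  then show ?thesis
  proof (rule AE_I')
    show "{k \<in> space lborel. \<not> (\<forall>n. trig_poly c L (real L ^ n * k) \<noteq> 0)}
        \<subseteq> (\<Union>n. (\<lambda>x. x / real L ^ n) ` {x. trig_poly c L x = 0})"
    proof clarsimp
      fix k n assume "trig_poly c L (real L ^ n * k) = 0"
      then show "\<exists>n. k \<in> (\<lambda>x. x / real L ^ n) ` {x. trig_poly c L x = 0}"
        using assms(1) by (intro exI[of _ n] image_eqI[of _ _ "real L ^ n * k"]) auto
    qed
  qed
qed

section \<open>Common eigenfunctions of commuting columns\<close>

text \<open>Roots of all orders are collected, so eigenvalues of permutations of any finite order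
  belong here, yet the set is countable.\<close>

definition roots_of_unity :: "complex set" where
  "roots_of_unity = {\<omega>. \<exists>N>0. \<omega> ^ N = 1}"

lemma countable_roots_of_unity: "countable roots_of_unity"
proof -
  have "roots_of_unity \<subseteq> (\<Union>N\<in>{0<..}. {\<omega>. \<omega> ^ N = 1})"
    by (auto simp: roots_of_unity_def)
  moreover have "countable (\<Union>N\<in>{0<..}. {\<omega>::complex. \<omega> ^ N = 1})"
  proof (rule countable_UN)
    fix N :: nat assume "N \<in> {0<..}"
    then have "finite {\<omega>::complex. \<omega> ^ N = 1}" by (intro finite_roots_unity) auto
    then show "countable {\<omega>::complex. \<omega> ^ N = 1}" by (rule countable_finite)
  qed simp
  ultimately show ?thesis by (rule countable_subset)
qed

lemma norm_root_of_unity: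
  assumes "\<omega> \<in> roots_of_unity"
  shows "norm \<omega> = 1"
proof -
  obtain N where "N > 0" "\<omega> ^ N = 1" using assms by (auto simp: roots_of_unity_def)
  then have "norm \<omega> ^ N = 1" by (metis norm_one norm_power)
  then show ?thesis using \<open>N > 0\<close> power_eq_imp_eq_base[of "norm \<omega>" N 1] by simp
qed

lemma bij_finite_order:
  fixes g :: "'a::finite \<Rightarrow> 'a"
  assumes "bij g"
  shows "\<exists>N>0. g ^^ N = id"
proof -
  have "\<not> inj (\<lambda>i. g ^^ i)"
    using finite_imageD[of "\<lambda>i. g ^^ i" "UNIV :: nat set"] by auto
  then obtain i j where ij: "i < j" "g ^^ i = g ^^ j"
    by (metis injI linorder_neqE_nat)
  have "inj (g ^^ i)"
    using assms by (simp add: bij_is_inj inj_fn)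
  have "(g ^^ i) ((g ^^ (j - i)) x) = (g ^^ i) x" for x
  proof -
    have "(g ^^ i) ((g ^^ (j - i)) x) = (g ^^ (i + (j - i))) x"
      by (simp only: funpow_add comp_apply)
    then show ?thesis using ij by simp
  qed
  then have "g ^^ (j - i) = id"
    using \<open>inj (g ^^ i)\<close> by (auto simp: fun_eq_iff dest: injD)
  then show ?thesis using ij(1) by (intro exI[of _ "j - i"]) auto
qed

text \<open>
  Projects \<open>l\<close> onto the eigenspaces of \<open>g\<close>; the projections sum to a multiple of \<open>l\<close>, so one of them
  still does not annihilate \<open>v\<close>.
\<close>
lemma ex_eigenfunction_of_permutation:
  fixes l v :: "'a::finite \<Rightarrow> complex"
  assumes lv: "(\<Sum>j\<in>UNIV. l j * v j) \<noteq> 0" and g: "bij g"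
  shows "\<exists>\<omega>\<in>roots_of_unity. \<exists>l'. (\<Sum>j\<in>UNIV. l' j * v j) \<noteq> 0 \<and> (\<forall>j. l' (g j) = \<omega> * l' j) \<and>
    (\<forall>h \<mu>. g \<circ> h = h \<circ> g \<longrightarrow> (\<forall>j. l (h j) = \<mu> * l j) \<longrightarrow> (\<forall>j. l' (h j) = \<mu> * l' j))"
proof -
  obtain N where N: "N > 0" "g ^^ N = id" using bij_finite_order[OF g] by blast
  \<comment> \<open>The summand 0 keeps the shape \<open>(y + i) / L\<close> of a fibre point, with
    \<open>y = 0\<close>, so that \<open>sum_fibre_orthogonal\<close> applies.\<close>
  define \<omega> where "\<omega> s = cis (2 * pi * ((0 + real s) / real N))" for s
  define l' where "l' s j = (\<Sum>i<N. cnj (\<omega> s ^ i) * l ((g ^^ i) j))" for s j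
  have \<omega>N: "\<omega> s ^ N = 1" for s
    unfolding \<omega>_def using N(1) by (simp only: cis_2pi_divide_power add_0 cis_2pi_of_nat)
  have \<omega>: "\<omega> s * cnj (\<omega> s) = 1" for s
    by (simp add: \<omega>_def complex_norm_square[symmetric])
  have eigen: "l' s (g j) = \<omega> s * l' s j" for s j
  proof -
    let ?h = "\<lambda>i. cnj (\<omega> s ^ i) * l ((g ^^ i) j)"
    have "l' s (g j) = (\<Sum>i<N. \<omega> s * ?h (Suc i))"
      unfolding l'_def
    proof (intro sum.cong refl)
      fix i
      have "\<omega> s * ?h (Suc i) = (\<omega> s * cnj (\<omega> s)) * (cnj (\<omega> s ^ i) * l ((g ^^ Suc i) j))"
        by (simp add: mult_ac)
      also have "\<dots> = cnj (\<omega> s ^ i) * l ((g ^^ i) (g j))"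
        by (simp only: \<omega> mult_1 funpow_Suc_right comp_apply)
      finally show "cnj (\<omega> s ^ i) * l ((g ^^ i) (g j)) = \<omega> s * ?h (Suc i)"
        by (rule sym)
    qed
    also have "\<dots> = \<omega> s * (\<Sum>i<N. ?h (Suc i))" by (rule sum_distrib_left[symmetric])
    \<comment> \<open>The index shift is cyclic: the terms 0 and N agree because both
      \<open>g\<close> and \<open>\<omega> s\<close> have order dividing N.\<close>
    also have "(\<Sum>i<N. ?h (Suc i)) = (\<Sum>i<N. ?h i)"
    proof -
      have "?h N = ?h 0" using N(2) \<omega>N[of s] by (simp del: complex_cnj_power)
      moreover have "(\<Sum>i<Suc N. ?h i) = ?h 0 + (\<Sum>i<N. ?h (Suc i))"
        by (rule sum.lessThan_Suc_shift)
      ultimately show ?thesis by simp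
    qed
    finally show ?thesis by (simp add: l'_def)
  qed
  \<comment> \<open>A map commuting with \<open>g\<close> passes through every summand, so
    eigenvalue relations already secured for \<open>l\<close> survive the projection.\<close>
  have commute: "l' s (h j) = \<mu> * l' s j"
    if "g \<circ> h = h \<circ> g" "\<forall>j. l (h j) = \<mu> * l j" for s h \<mu> j
  proof -
    have "(g ^^ i) (h j) = h ((g ^^ i) j)" for i
      using that(1) by (induction i) (auto simp: fun_eq_iff)
    then show ?thesis using that(2) by (simp add: l'_def sum_distrib_left mult_ac)
  qed
  \<comment> \<open>Summing over all N-th roots of unity kills every power of \<open>g\<close>
    except the identity.\<close>
  have "(\<Sum>s<N. l' s j) = of_nat N * l j" for j
  proof -
    have "(\<Sum>s<N. l' s j) = (\<Sum>i<N. (\<Sum>s<N. cnj (\<omega> s ^ i)) * l ((g ^^ i) j))"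
      unfolding l'_def sum_distrib_right by (rule sum.swap)
    also have "\<dots> = (\<Sum>i<N. if i = 0 then of_nat N * l j else 0)"
    proof (intro sum.cong refl)
      fix i assume "i \<in> {..<N}"
      then have "(\<Sum>s<N. cnj (\<omega> s ^ i)) = 0" if "i \<noteq> 0"
        using sum_fibre_orthogonal[of 0 N i 0] that N(1) by (simp add: \<omega>_def)
      then show "(\<Sum>s<N. cnj (\<omega> s ^ i)) * l ((g ^^ i) j) = (if i = 0 then of_nat N * l j else 0)"
        by auto
    qed
    also have "\<dots> = of_nat N * l j" using N(1) by simp
    finally show ?thesis .
  qed
  moreover have "(\<Sum>s<N. \<Sum>j\<in>UNIV. l' s j * v j) = (\<Sum>j\<in>UNIV. (\<Sum>s<N. l' s j) * v j)"
    unfolding sum_distrib_right by (rule sum.swap)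
  ultimately have "(\<Sum>s<N. \<Sum>j\<in>UNIV. l' s j * v j) = of_nat N * (\<Sum>j\<in>UNIV. l j * v j)"
    by (simp add: sum_distrib_left mult.assoc)
  then have "(\<Sum>s<N. \<Sum>j\<in>UNIV. l' s j * v j) \<noteq> 0"
    using lv N(1) by simp
  then obtain s where "(\<Sum>j\<in>UNIV. l' s j * v j) \<noteq> 0"
    by (metis (no_types, lifting) sum.neutral)
  moreover have "\<omega> s \<in> roots_of_unity"
    using \<omega>N N(1) by (auto simp: roots_of_unity_def)
  ultimately show ?thesis using eigen commute by blast
qed

text \<open>Joint diagonalisation: start from the indicator of a letter where \<open>v\<close> is
  nonzero and project for one permutation after another, keeping the earlier eigenvalues and the
  nonzero pairing with \<open>v\<close>.\<close>

lemma ex_common_eigenfunction: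
  fixes v :: "'a::finite \<Rightarrow> complex"
  assumes "finite S" and "\<And>g. g \<in> S \<Longrightarrow> bij g"
    and "\<And>g h. g \<in> S \<Longrightarrow> h \<in> S \<Longrightarrow> g \<circ> h = h \<circ> g" and "v \<noteq> (\<lambda>_. 0)"
  shows "\<exists>l. (\<Sum>j\<in>UNIV. l j * v j) \<noteq> 0 \<and> (\<forall>g\<in>S. \<exists>\<omega>\<in>roots_of_unity. \<forall>j. l (g j) = \<omega> * l j)"
  using assms(1-3)
proof (induction S rule: finite_induct)
  case empty
  obtain i where "v i \<noteq> 0" using assms(4) by auto
  then have "(\<Sum>j\<in>UNIV. (if j = i then 1 else 0) * v j) \<noteq> 0"
    by (simp add: if_distrib[of "\<lambda>x. x * _"] cong: if_cong)
  then show ?case by (intro exI[of _ "\<lambda>j. if j = i then 1 else 0"]) auto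
next
  case (insert g S)
  then obtain l where l: "(\<Sum>j\<in>UNIV. l j * v j) \<noteq> 0"
      "\<forall>h\<in>S. \<exists>\<omega>\<in>roots_of_unity. \<forall>j. l (h j) = \<omega> * l j"
    by auto
  have "bij g" using insert.prems by simp
  from ex_eigenfunction_of_permutation[OF l(1) this] obtain \<omega> l' where
    "\<omega> \<in> roots_of_unity" "(\<Sum>j\<in>UNIV. l' j * v j) \<noteq> 0" "\<forall>j. l' (g j) = \<omega> * l' j" and
    comm: "\<And>h \<mu>. g \<circ> h = h \<circ> g \<Longrightarrow> \<forall>j. l (h j) = \<mu> * l j \<Longrightarrow> \<forall>j. l' (h j) = \<mu> * l' j"
    by blast
  moreover have "\<exists>\<omega>\<in>roots_of_unity. \<forall>j. l' (h j) = \<omega> * l' j" if "h \<in> S" for h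
    using comm[of h] insert.prems(2)[of g h] l(2) that by blast
  ultimately show ?case by blast
qed

section \<open>The Fourier matrix in terms of the columns\<close>

text \<open>B(k) is the sum over \<open>r\<close> of \<open>cis (2 * pi * k) ^ r\<close> times the
  0-1 matrix of column \<open>r\<close>; pairing with \<open>l\<close> from the left composes
  \<open>l\<close> with that column.\<close>

lemma pairing_fourier_matrix:
  fixes \<rho> :: "'a::finite \<Rightarrow> 'a list" and y :: "complex ^ 'a"
  shows "(\<Sum>i\<in>UNIV. l i * (fourier_matrix \<rho> L k *v y) $ i)
       = (\<Sum>r<L. cis (2 * pi * k) ^ r * (\<Sum>j\<in>UNIV. l (subst_column \<rho> r j) * y $ j))"
proof -
  let ?e = "\<lambda>t. exp (2 * of_real pi * \<i> * of_nat t * of_real k)"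
  have e: "?e t = cis (2 * pi * k) ^ t" for t
    by (simp add: cis_conv_exp mult_ac flip: exp_of_nat_mult)
  have pos: "positions \<rho> L i j = {t \<in> {..<L}. \<rho> j ! t = i}" for i j
    by (auto simp: positions_def)
  have F: "fourier_matrix \<rho> L k $ i $ j = (\<Sum>t<L. if \<rho> j ! t = i then ?e t else 0)" for i j
    unfolding fourier_matrix_def pos by (simp only: vec_lambda_beta finite_lessThan sum.inter_filter)
  have "(\<Sum>i\<in>UNIV. l i * (fourier_matrix \<rho> L k *v y) $ i)
      = (\<Sum>i\<in>UNIV. \<Sum>j\<in>UNIV. \<Sum>t<L. if \<rho> j ! t = i then l i * ?e t * y $ j else 0)"
    by (simp add: matrix_vector_mult_def F sum_distrib_left sum_distrib_right mult.assoc
          if_distrib[of "\<lambda>x. x * _"] if_distrib[of "\<lambda>x. _ * x"] cong: if_cong)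
  also have "\<dots> = (\<Sum>j\<in>UNIV. \<Sum>i\<in>UNIV. \<Sum>t<L. if \<rho> j ! t = i then l i * ?e t * y $ j else 0)"
    by (rule sum.swap)
  also have "\<dots> = (\<Sum>j\<in>UNIV. \<Sum>t<L. \<Sum>i\<in>UNIV. if \<rho> j ! t = i then l i * ?e t * y $ j else 0)"
    by (intro sum.cong refl) (rule sum.swap)
  also have "\<dots> = (\<Sum>j\<in>UNIV. \<Sum>t<L. l (\<rho> j ! t) * ?e t * y $ j)"
    by simp
  also have "\<dots> = (\<Sum>t<L. \<Sum>j\<in>UNIV. l (\<rho> j ! t) * ?e t * y $ j)"
    by (rule sum.swap)
  also have "\<dots> = (\<Sum>r<L. cis (2 * pi * k) ^ r * (\<Sum>j\<in>UNIV. l (subst_column \<rho> r j) * y $ j))"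
    by (simp only: e) (simp only: subst_column_def sum_distrib_left mult_ac)
  finally show ?thesis .
qed

lemma commute_bijective_columns:
  assumes "comm_group (column_group \<rho> L)" "f \<in> bijective_columns \<rho> L" "g \<in> bijective_columns \<rho> L"
  shows "f \<circ> g = g \<circ> f"
proof -
  let ?G = "BijGroup (UNIV :: 'a set)"
  interpret G: group ?G by (rule group_BijGroup)
  have sub: "bijective_columns \<rho> L \<subseteq> carrier ?G"
    by (auto simp: bijective_columns_def BijGroup_def Bij_def)
  then have "f \<in> carrier (column_group \<rho> L)" "g \<in> carrier (column_group \<rho> L)"
    using assms(2,3) by (auto simp: column_group_def carrier_subgroup_generated intro: generate.incl)
  then have "f \<otimes>\<^bsub>column_group \<rho> L\<^esub> g = g \<otimes>\<^bsub>column_group \<rho> L\<^esub> f"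
    by (rule comm_monoid.m_comm[OF comm_group.axioms(1)[OF assms(1)]])
  then have "f \<otimes>\<^bsub>?G\<^esub> g = g \<otimes>\<^bsub>?G\<^esub> f"
    by (simp add: column_group_def)
  moreover have "f \<in> Bij UNIV" "g \<in> Bij UNIV"
    using sub assms(2,3) by (auto simp: BijGroup_def)
  ultimately have "compose UNIV f g = compose UNIV g f"
    by (simp add: BijGroup_def)
  then have "f (g x) = g (f x)" for x
    by (metis UNIV_I compose_eq)
  then show ?thesis by auto
qed

section \<open>Primitivity and aperiodicity\<close>

text \<open>The columns of the n-th matrix power sum to \<open>L ^ n\<close>. A column with all
  entries positive sums to at least the number of letters, so \<open>L ^ N \<ge> 2\<close>.\<close>

lemma primitive_subst_length_ge_2:
  fixes \<rho> :: "'a::finite \<Rightarrow> 'a list"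
  assumes len: "constant_length \<rho> L" and prim: "primitive_subst \<rho>" and card: "CARD('a) \<ge> 2"
  shows "L \<ge> 2"
proof -
  let ?P = "\<lambda>n. (((**) (subst_matrix \<rho>) ^^ n) (mat 1))"
  have col: "(\<Sum>i\<in>UNIV. subst_matrix \<rho> $ i $ j) = L" for j
    using len sum_count_set[of "\<rho> j" UNIV] by (simp add: subst_matrix_def constant_length_def)
  have pow: "(\<Sum>i\<in>UNIV. ?P n $ i $ j) = L ^ n" for n j
  proof (induction n)
    case 0
    then show ?case by (simp add: mat_def)
  next
    case (Suc n)
    have "(\<Sum>i\<in>UNIV. ?P (Suc n) $ i $ j)
        = (\<Sum>i\<in>UNIV. \<Sum>k\<in>UNIV. subst_matrix \<rho> $ i $ k * ?P n $ k $ j)"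
      by (simp add: matrix_matrix_mult_def)
    also have "\<dots> = (\<Sum>k\<in>UNIV. (\<Sum>i\<in>UNIV. subst_matrix \<rho> $ i $ k) * ?P n $ k $ j)"
      unfolding sum_distrib_right by (rule sum.swap)
    also have "\<dots> = L * L ^ n"
      by (simp only: col Suc.IH flip: sum_distrib_left)
    finally show ?case by simp
  qed
  obtain N where N: "\<And>i j. ?P N $ i $ j > 0"
    using prim unfolding primitive_subst_def primitive_matrix_def by blast
  have "CARD('a) = (\<Sum>i\<in>(UNIV::'a set). 1)" by simp
  also have "\<dots> \<le> (\<Sum>i\<in>UNIV. ?P N $ i $ undefined)"
    by (intro sum_mono) (use N in \<open>simp add: Suc_le_eq\<close>)
  finally have "CARD('a) \<le> L ^ N" by (simp only: pow)
  then have "2 \<le> L ^ N" using card by simp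
  show ?thesis
  proof (rule ccontr)
    assume "\<not> L \<ge> 2"
    then have "L ^ N \<le> 1" by (intro power_le_one) auto
    with \<open>2 \<le> L ^ N\<close> show False by simp
  qed
qed

text \<open>Every \<open>w\<close> lies in its own hull, so a period of \<open>w\<close> already
  violates aperiodicity. Since \<open>aperiodic_subst\<close> asks only for some suitable
  \<open>w\<close>, all words fixed by a power must be treated.\<close>

lemma not_aperiodic_substI:
  fixes \<rho> :: "'a \<Rightarrow> 'a list"
  assumes "\<And>w p. p \<ge> 1 \<Longrightarrow> (subst_biinf \<rho> L ^^ p) w = w \<Longrightarrow> \<exists>t. t \<noteq> 0 \<and> shift_biinf t w = w"
  shows "\<not> aperiodic_subst \<rho> L"
proof
  assume "aperiodic_subst \<rho> L"
  then obtain w where "\<exists>p\<ge>1. (subst_biinf \<rho> L ^^ p) w = w"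
    and ap: "\<forall>x\<in>biinf_hull w. \<forall>t. t \<noteq> 0 \<longrightarrow> shift_biinf t x \<noteq> x"
    unfolding aperiodic_subst_def by - (erule exE, erule conjE, rule that)
  then obtain p where w: "p \<ge> 1" "(subst_biinf \<rho> L ^^ p) w = w"
    by (elim exE conjE) (rule that)
  have "range (\<lambda>t. shift_biinf t w) \<subseteq> biinf_hull w"
    unfolding biinf_hull_def
    by (rule closure_of_subset) (simp add: biinf_topology_def topspace_product_topology)
  moreover have "w = shift_biinf 0 w" by (simp add: shift_biinf_def)
  ultimately have "w \<in> biinf_hull w" by (metis rangeI subsetD)
  then show False using ap assms[OF w] by blast
qed

lemma aperiodic_subst_card_ge_2:
  fixes \<rho> :: "'a::finite \<Rightarrow> 'a list"
  assumes "aperiodic_subst \<rho> L"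
  shows "CARD('a) \<ge> 2"
proof (rule ccontr)
  assume "\<not> CARD('a) \<ge> 2"
  then have "\<forall>x y :: 'a. x = y"
    using card_le_Suc0_iff_eq[of "UNIV :: 'a set"] by simp
  then have "shift_biinf 1 w = w" for w :: "int \<Rightarrow> 'a" by (intro ext) blast
  then have "\<not> aperiodic_subst \<rho> L" by (intro not_aperiodic_substI exI[of _ 1]) simp
  then show False using assms by blast
qed

text \<open>If all columns are constant, a letter of an image word depends only on its position
  modulo L. A word fixed by a power is itself an image, hence has period L.\<close>

lemma aperiodic_subst_ex_bijective_column:
  fixes \<rho> :: "'a::finite \<Rightarrow> 'a list"
  assumes ap: "aperiodic_subst \<rho> L" and L: "L > 0"
    and cols: "\<forall>r<L. bij (subst_column \<rho> r) \<or> constant_map (subst_column \<rho> r)"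
  shows "\<exists>r<L. bij (subst_column \<rho> r)"
proof (rule ccontr)
  assume "\<not> ?thesis"
  then have const: "\<And>r. r < L \<Longrightarrow> constant_map (subst_column \<rho> r)" using cols by blast
  have per: "shift_biinf (int L) (subst_biinf \<rho> L w) = subst_biinf \<rho> L w" for w
  proof
    fix n
    have "nat (n mod int L) < L" using L by (simp add: nat_less_iff)
    then obtain a where "\<And>b. \<rho> b ! nat (n mod int L) = a"
      using const[of "nat (n mod int L)"] by (auto simp: constant_map_def subst_column_def)
    then show "shift_biinf (int L) (subst_biinf \<rho> L w) n = subst_biinf \<rho> L w n"
      by (simp add: shift_biinf_def subst_biinf_def)
  qed
  have "\<not> aperiodic_subst \<rho> L"
  proof (rule not_aperiodic_substI)
    fix w :: "int \<Rightarrow> 'a" and p :: nat assume p: "p \<ge> 1" and w: "(subst_biinf \<rho> L ^^ p) w = w"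
    obtain q where "p = Suc q" using p by (cases p) auto
    then have "w = subst_biinf \<rho> L ((subst_biinf \<rho> L ^^ q) w)" using w by simp
    then have "shift_biinf (int L) w = w" using per by metis
    then show "\<exists>t. t \<noteq> 0 \<and> shift_biinf t w = w" using L by (intro exI[of _ "int L"]) simp
  qed
  then show False using ap by blast
qed

section \<open>Positivity of the Lyapunov exponents\<close>

lemma limsup_exponential_growth_pos:
  fixes x :: "nat \<Rightarrow> real"
  assumes a: "a > 0" and q: "q > 1" and x: "\<And>n. a * q ^ n \<le> x n"
  shows "0 < limsup (\<lambda>n. ereal (1 / real n * ln (x n)))"
proof -
  have "(\<lambda>n. ereal (ln a * (1 / real n) + ln q)) \<longlonglongrightarrow> ereal (ln a * 0 + ln q)"
    by (intro tendsto_intros lim_1_over_n)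
  then have lim: "limsup (\<lambda>n. ereal (ln a * (1 / real n) + ln q)) = ereal (ln a * 0 + ln q)"
    by (intro lim_imp_Limsup) auto
  have "0 < ereal (ln q)" using q by simp
  also have "\<dots> = limsup (\<lambda>n. ereal (ln a * (1 / real n) + ln q))"
    by (simp only: lim) simp
  also have "\<dots> \<le> limsup (\<lambda>n. ereal (1 / real n * ln (x n)))"
  \<comment> \<open>Index 0, where division by zero gives 0, is discarded.\<close>
  proof (intro Limsup_mono eventually_mono[OF eventually_gt_at_top[of 0]])
    fix n :: nat assume n: "n > 0"
    have pos: "0 < a * q ^ n" using a q by simp
    have "ln (a * q ^ n) \<le> ln (x n)"
      using pos x[of n] by (subst ln_le_cancel_iff) linarith+
    moreover have "ln (a * q ^ n) = ln a + real n * ln q"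
      using a q by (simp add: ln_mult ln_realpow)
    ultimately have "1 / real n * (ln a + real n * ln q) \<le> 1 / real n * ln (x n)"
      by (intro mult_left_mono) auto
    then show "ereal (ln a * (1 / real n) + ln q) \<le> ereal (1 / real n * ln (x n))"
      using n by (simp add: field_simps)
  qed
  finally show ?thesis .
qed

text \<open>
  A countable set of possible coefficient sequences, so that almost every \<open>k\<close> works for all of them
  at once.
\<close>
definition column_spectrum :: "nat \<Rightarrow> (nat \<Rightarrow> complex) set" where
  "column_spectrum L = {c \<in> {..<L} \<rightarrow>\<^sub>E insert 0 roots_of_unity. \<exists>r<L. c r \<noteq> 0}"

text \<open>For a common eigenfunction \<open>l\<close>, a bijective column contributes its
  eigenvalue. A constant column turns \<open>l\<close> into a constant, which pairs to 0 with
  \<open>y\<close>, so its coefficient is 0. As \<open>c\<close> and \<open>l\<close> precede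
  \<open>k\<close> and \<open>y\<close>, one pair serves a whole orbit.\<close>

lemma ex_fourier_eigenfunctional:
  fixes \<rho> :: "'a::finite \<Rightarrow> 'a list" and x :: "complex ^ 'a"
  assumes cols: "\<forall>r<L. bij (subst_column \<rho> r) \<or> constant_map (subst_column \<rho> r)"
    and comm: "comm_group (column_group \<rho> L)"
    and ex_bij: "\<exists>r<L. bij (subst_column \<rho> r)"
    and x: "x \<noteq> 0" "(\<Sum>j\<in>UNIV. x $ j) = 0"
  shows "\<exists>c\<in>column_spectrum L. \<exists>l. (\<Sum>j\<in>UNIV. l j * x $ j) \<noteq> 0 \<and>
    (\<forall>k y. (\<Sum>j\<in>UNIV. y $ j) = 0 \<longrightarrow>
      (\<Sum>i\<in>UNIV. l i * (fourier_matrix \<rho> L k *v y) $ i) = trig_poly c L k * (\<Sum>j\<in>UNIV. l j * y $ j))"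
proof -
  let ?S = "bijective_columns \<rho> L"
  have "(\<lambda>j. x $ j) \<noteq> (\<lambda>_. 0)" using x(1) by (auto simp: vec_eq_iff fun_eq_iff)
  moreover have "finite ?S" by simp
  moreover have "bij g" if "g \<in> ?S" for g using that by (auto simp: bijective_columns_def)
  ultimately have "\<exists>l. (\<Sum>j\<in>UNIV. l j * x $ j) \<noteq> 0 \<and>
      (\<forall>g\<in>?S. \<exists>\<omega>\<in>roots_of_unity. \<forall>j. l (g j) = \<omega> * l j)"
    using commute_bijective_columns[OF comm] by (intro ex_common_eigenfunction) auto
  then obtain l where l: "(\<Sum>j\<in>UNIV. l j * x $ j) \<noteq> 0"
      "\<forall>g\<in>?S. \<exists>\<omega>\<in>roots_of_unity. \<forall>j. l (g j) = \<omega> * l j"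
    by blast
  obtain \<omega> where \<omega>: "\<And>g. g \<in> ?S \<Longrightarrow> \<omega> g \<in> roots_of_unity"
      "\<And>g j. g \<in> ?S \<Longrightarrow> l (g j) = \<omega> g * l j"
    using l(2) by metis
  define c where "c = (\<lambda>r\<in>{..<L}. if bij (subst_column \<rho> r) then \<omega> (subst_column \<rho> r) else 0)"
  have S: "subst_column \<rho> r \<in> ?S" if "r < L" "bij (subst_column \<rho> r)" for r
    using that by (auto simp: bijective_columns_def)
  obtain r where r: "r < L" "bij (subst_column \<rho> r)" using ex_bij by blast
  have "c r \<noteq> 0" using norm_root_of_unity[OF \<omega>(1)[OF S[OF r]]] r by (auto simp: c_def)
  moreover have "c \<in> {..<L} \<rightarrow>\<^sub>E insert 0 roots_of_unity"
    using \<omega>(1) S by (auto simp: c_def)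
  ultimately have "c \<in> column_spectrum L"
    using r(1) by (auto simp: column_spectrum_def)
  moreover have "(\<Sum>i\<in>UNIV. l i * (fourier_matrix \<rho> L k *v y) $ i)
      = trig_poly c L k * (\<Sum>j\<in>UNIV. l j * y $ j)" if y: "(\<Sum>j\<in>UNIV. y $ j) = 0" for k and y :: "complex ^ 'a"
  proof -
    have "(\<Sum>j\<in>UNIV. l (subst_column \<rho> r j) * y $ j) = c r * (\<Sum>j\<in>UNIV. l j * y $ j)" if "r < L" for r
    proof (cases "bij (subst_column \<rho> r)")
      case True
      then show ?thesis using that \<omega>(2)[OF S[OF that True]]
        by (simp add: c_def sum_distrib_left mult.assoc)
    next
      case False
      then have "constant_map (subst_column \<rho> r)" using cols that by blast
      then obtain a where "\<And>j. subst_column \<rho> r j = a"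
        unfolding constant_map_def by blast
      then show ?thesis using False that y by (simp add: c_def flip: sum_distrib_left)
    qed
    then have "(\<Sum>i\<in>UNIV. l i * (fourier_matrix \<rho> L k *v y) $ i)
        = (\<Sum>r<L. c r * cis (2 * pi * k) ^ r * (\<Sum>j\<in>UNIV. l j * y $ j))"
      unfolding pairing_fourier_matrix by (intro sum.cong refl) simp
    then show ?thesis
      unfolding trig_poly_def by (subst sum_distrib_right)
  qed
  ultimately show ?thesis using l(1) by blast
qed

text \<open>Extensionality leaves only L free coordinates, each in a countable set.\<close>

lemma countable_column_spectrum: "countable (column_spectrum L)"
proof -
  have "countable ({..<L} \<rightarrow>\<^sub>E insert 0 roots_of_unity)"
    by (intro countable_PiE) (simp_all add: countable_roots_of_unity)
  then show ?thesis
    unfolding column_spectrum_def by (rule countable_subset[rotated]) auto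
qed

lemma ones_in_column_spectrum:
  assumes "L > 0"
  shows "(\<lambda>r\<in>{..<L}. 1) \<in> column_spectrum L"
proof -
  have "1 \<in> roots_of_unity"
    by (auto simp: roots_of_unity_def intro: exI[of _ 1])
  then show ?thesis
    using assms by (auto simp: column_spectrum_def)
qed

text \<open>The functional 1 is fixed by composition with any column, so every coefficient is
  1.\<close>

lemma sum_fourier_matrix:
  fixes \<rho> :: "'a::finite \<Rightarrow> 'a list" and y :: "complex ^ 'a"
  shows "(\<Sum>i\<in>UNIV. (fourier_matrix \<rho> L k *v y) $ i)
       = trig_poly (\<lambda>r\<in>{..<L}. 1) L k * (\<Sum>j\<in>UNIV. y $ j)"
  using pairing_fourier_matrix[of "\<lambda>_. 1" \<rho> L k y]
  by (simp add: trig_poly_def sum_distrib_right)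

lemma AE_column_spectrum:
  assumes "L \<ge> 2"
  shows "AE k in lborel. \<forall>c\<in>column_spectrum L.
    (\<forall>n. trig_poly c L (real L ^ n * k) \<noteq> 0) \<and>
    (\<exists>C s. 0 < s \<and> s < sqrt (real L) \<and>
      (\<forall>n. (\<Prod>j<n. norm (trig_poly c L (real L ^ j * k))) \<le> C * s ^ n))"
proof (rule AE_ball_countable'[OF _ countable_column_spectrum])
  fix c assume c: "c \<in> column_spectrum L"
  then obtain r where "r < L" "c r \<noteq> 0" by (auto simp: column_spectrum_def)
  note nonzero = AE_trig_poly_nonzero[of r L c, OF this]
  have "norm (c r) \<le> 1" if "r < L" for r
  proof -
    have "c r \<in> insert 0 roots_of_unity" using c that by (auto simp: column_spectrum_def)
    then show ?thesis using norm_root_of_unity[of "c r"] by auto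
  qed
  note bound = AE_prod_trig_poly_le[of L c, OF this assms]
  show "AE k in lborel. (\<forall>n. trig_poly c L (real L ^ n * k) \<noteq> 0) \<and>
    (\<exists>C s. 0 < s \<and> s < sqrt (real L) \<and>
      (\<forall>n. (\<Prod>j<n. norm (trig_poly c L (real L ^ j * k))) \<le> C * s ^ n))"
    using nonzero bound by (rule AE_conjI)
qed

text \<open>Invertibility along the orbit belongs to the conclusion because
  \<open>matrix_inv\<close> is an unspecified matrix otherwise.\<close>

theorem theorem4p7:
  fixes \<rho> :: "'a::finite \<Rightarrow> 'a list" and L :: nat
  assumes "constant_length \<rho> L"
    and "primitive_subst \<rho>"
    and "aperiodic_subst \<rho> L"
    and "\<forall>r<L. bij (subst_column \<rho> r) \<or> constant_map (subst_column \<rho> r)"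
    and "comm_group (column_group \<rho> L)"
  shows "AE k in lborel.
           (\<forall>n. invertible (fourier_matrix \<rho> L (real L ^ n * k))) \<and>
           (\<forall>x\<in>lyapunov_exponents \<rho> L k. x > 0)"
proof -
  have L: "L \<ge> 2"
    using assms(1,2) aperiodic_subst_card_ge_2[OF assms(3)] by (rule primitive_subst_length_ge_2)
  then have ex_bij: "\<exists>r<L. bij (subst_column \<rho> r)"
    using aperiodic_subst_ex_bijective_column[OF assms(3) _ assms(4)] by simp
  let ?one = "\<lambda>r\<in>{..<L}. 1 :: complex"
  have one: "?one \<in> column_spectrum L" using L by (intro ones_in_column_spectrum) simp
  show ?thesis
    using AE_column_spectrum[OF L]
  proof eventually_elim
    case (elim k)
    define B where "B n = fourier_matrix \<rho> L (real L ^ n * k)" for n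
    have nz: "trig_poly c L (real L ^ n * k) \<noteq> 0" if "c \<in> column_spectrum L" for c n
      using elim that by blast
    have sum_zero: "(\<Sum>j\<in>UNIV. y $ j) = 0" if "(\<Sum>i\<in>UNIV. (B n *v y) $ i) = 0" for n y
      using that nz[OF one] by (simp add: B_def sum_fourier_matrix)
    \<comment> \<open>The premise on \<open>y\<close> merges two cases: for \<open>v\<close> of zero
      sum it restricts \<open>y\<close> to zero sum, as constant columns demand; otherwise it is
      void and \<open>l = 1\<close> works for every \<open>y\<close>.\<close>
    have functional: "\<exists>c\<in>column_spectrum L. \<exists>l. (\<Sum>j\<in>UNIV. l j * v $ j) \<noteq> 0 \<and>
        (\<forall>n y. ((\<Sum>j\<in>UNIV. v $ j) = 0 \<longrightarrow> (\<Sum>j\<in>UNIV. y $ j) = 0) \<longrightarrow>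
          (\<Sum>i\<in>UNIV. l i * (B n *v y) $ i)
            = trig_poly c L (real L ^ n * k) * (\<Sum>j\<in>UNIV. l j * y $ j))"
      if "v \<noteq> 0" for v
    proof (cases "(\<Sum>j\<in>UNIV. v $ j) = 0")
      case True
      then show ?thesis
        using ex_fourier_eigenfunctional[OF assms(4,5) ex_bij that] unfolding B_def by blast
    next
      case False
      then show ?thesis
        using one by (intro bexI[of _ ?one] exI[of _ "\<lambda>_. 1"]) (simp_all add: B_def sum_fourier_matrix)
    qed
    have inv: "invertible (B n)" for n
    proof -
      have "y = 0" if y: "B n *v y = 0" for y
      proof (rule ccontr)
        assume "y \<noteq> 0"
        \<comment> \<open>The functional adapted to the kernel vector itself yields 0 as a product
          of two nonzero numbers.\<close>
        from functional[OF this] obtain c l where cl: "c \<in> column_spectrum L"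
          "(\<Sum>j\<in>UNIV. l j * y $ j) \<noteq> 0"
          "(\<Sum>i\<in>UNIV. l i * (B n *v y) $ i) = trig_poly c L (real L ^ n * k) * (\<Sum>j\<in>UNIV. l j * y $ j)"
          by blast
        then show False using y nz[OF cl(1)] by simp
      qed
      then show ?thesis
        unfolding invertible_left_inverse matrix_left_invertible_ker by blast
    qed
    have "0 < limsup (\<lambda>n. ereal (1 / real n * ln (norm (outward_iterate \<rho> L k v n))))"
      if v: "v \<noteq> 0" for v
    proof -
      define u where "u n = inverse_cocycle \<rho> L k n *v v" for n
      have u0: "u 0 = v" by (simp add: u_def)
      \<comment> \<open>Inverses enter the growth estimate only through this backward relation, so
        the eigenfunctional identity for B suffices.\<close>
      have Bu: "B n *v u (Suc n) = u n" for n
      proof -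
        have "B n ** matrix_inv (B n) = mat 1"
          using inv[of n] unfolding invertible_def matrix_inv_def by (rule someI2_ex) simp
        then show ?thesis
          by (simp add: u_def matrix_vector_mul_assoc matrix_mul_assoc flip: B_def)
      qed
      have u_sum: "(\<Sum>j\<in>UNIV. u n $ j) = 0" if "(\<Sum>j\<in>UNIV. v $ j) = 0" for n
      proof (induction n)
        case (Suc n)
        then show ?case using sum_zero[of n "u (Suc n)"] by (simp add: Bu)
      qed (use that u0 in simp)
      obtain c l where c: "c \<in> column_spectrum L" and lv: "(\<Sum>j\<in>UNIV. l j * v $ j) \<noteq> 0"
        and l: "\<And>n y. (\<Sum>j\<in>UNIV. v $ j) = 0 \<longrightarrow> (\<Sum>j\<in>UNIV. y $ j) = 0 \<Longrightarrow>
          (\<Sum>i\<in>UNIV. l i * (B n *v y) $ i)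
            = trig_poly c L (real L ^ n * k) * (\<Sum>j\<in>UNIV. l j * y $ j)"
        using functional[OF v] by blast
      define X where "X n = (\<Prod>j<n. norm (trig_poly c L (real L ^ j * k)))" for n
      define M where "M = (\<Sum>j\<in>UNIV. norm (l j))"
      define m where "m = norm (\<Sum>j\<in>UNIV. l j * v $ j)"
      \<comment> \<open>Telescoping: the pairing of \<open>l\<close> with \<open>u n\<close> loses
        the factor \<open>trig_poly c L (real L ^ n * k)\<close> at each step, so its product with
        \<open>X n\<close> is constant. Small \<open>X n\<close> therefore forces large
        \<open>u n\<close>.\<close>
      have m_eq: "m = X n * norm (\<Sum>j\<in>UNIV. l j * u n $ j)" for n
      proof (induction n)
        case (Suc n)
        have "(\<Sum>j\<in>UNIV. l j * u n $ j)
            = trig_poly c L (real L ^ n * k) * (\<Sum>j\<in>UNIV. l j * u (Suc n) $ j)"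
          using l[of "u (Suc n)" n] u_sum by (simp add: Bu)
        then show ?case using Suc.IH by (simp add: X_def norm_mult)
      qed (simp add: m_def X_def u0)
      have le_norm_u: "norm (\<Sum>j\<in>UNIV. l j * u n $ j) \<le> M * norm (u n)" for n
        unfolding M_def sum_distrib_right
        by (rule sum_norm_le) (auto simp: norm_mult intro!: mult_left_mono Finite_Cartesian_Product.norm_nth_le)
      obtain C s where s: "0 < s" "s < sqrt (real L)" and X_le: "\<And>n. X n \<le> C * s ^ n"
        using elim c unfolding X_def by blast
      have X_nonneg: "X n \<ge> 0" for n unfolding X_def by (intro prod_nonneg) simp
      have "m > 0" using lv by (simp add: m_def)
      have m_le: "m \<le> (C * s ^ n) * (M * norm (u n))" for n
      proof -
        have "m \<le> X n * (M * norm (u n))"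
          unfolding m_eq[of n] by (intro mult_left_mono le_norm_u X_nonneg)
        also have "\<dots> \<le> (C * s ^ n) * (M * norm (u n))"
          by (intro mult_right_mono X_le) (auto simp: M_def intro!: mult_nonneg_nonneg sum_nonneg)
        finally show ?thesis .
      qed
      \<comment> \<open>At n = 0 the product is empty, so \<open>1 \<le> C\<close>.\<close>
      have "C > 0"
        using X_le[of 0] by (simp add: X_def)
      have "M \<ge> 0" by (simp add: M_def sum_nonneg)
      moreover have "M \<noteq> 0" using m_le[of 0] \<open>m > 0\<close> by auto
      ultimately have "M > 0" by simp
      \<comment> \<open>The prefactor is \<open>sqrt L ^ n\<close> and \<open>u n\<close> has norm
        at least a constant over \<open>s ^ n\<close>; the growth rate \<open>sqrt L / s\<close>
        exceeds 1.\<close>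
      have "m / (C * M) * (sqrt (real L) / s) ^ n \<le> norm (outward_iterate \<rho> L k v n)" for n
      proof -
        have "real L powr (real n / 2) = sqrt (real L) ^ n"
          using L by (simp add: powr_half_sqrt[symmetric] powr_powr flip: powr_realpow)
        then have "norm (outward_iterate \<rho> L k v n) = sqrt (real L) ^ n * norm (u n)"
          by (simp add: outward_iterate_def u_def)
        moreover have "m / (C * M) / s ^ n \<le> norm (u n)"
          using m_le[of n] \<open>C > 0\<close> \<open>M > 0\<close> s(1) by (simp add: field_simps)
        then have "sqrt (real L) ^ n * (m / (C * M) / s ^ n) \<le> sqrt (real L) ^ n * norm (u n)"
          by (rule mult_left_mono) simp
        ultimately show ?thesis by (simp add: power_divide mult_ac)
      qed
      then show ?thesis
        using \<open>m > 0\<close> \<open>C > 0\<close> \<open>M > 0\<close> s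
        by (intro limsup_exponential_growth_pos[of "m / (C * M)" "sqrt (real L) / s"]) auto
    qed
    then show ?case
      using inv unfolding lyapunov_exponents_def B_def by blast
  qed
qed

end
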